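(* Let $f:\omega\to\omega$ be not generically computable. Then $\mu(\{X\subseteq\omega : f \text{ is generically computable relative to } X\})=0$; indeed, no element of this class is weakly $4$-random relative to $f$. Consequently, for every set $A\subseteq\omega$ that is not generically computable, the classes $\{X : A\le_{\mathrm{ug}} X\}$ and $\{X: A\le_{\mathrm{ng}} X\}$ have measure $0$.
   Context: $\mu$ is Lebesgue (fair-coin) measure on $2^\omega$, identifying sets with their characteristic sequences. For $A\subseteq\omega$, $\rho_n(A)=|A\cap\{0,\dots,n-1\}|/n$ and $\rho(A)=\lim_n\rho_n(A)$ when it exists. A generic description of $g:\omega\to\omega$ is a partial function $d$ with $d(n)=g(n)$ whenever $d(n)$ is defined and $\rho(\mathrm{dom}\, d)=1$. $g$ is generically computable (relative to $X$) if it has a partial computable (partial $X$-computable) generic description. A set $X$ is weakly $n$-random relative to $Z$ if $X$ lies in no $\Pi^{0,Z}_n$ class of measure $0$. An enumeration operator is a c.e. set $W$ of pairs $(F,k)$ with $F$ finite; $W^Y=\{k: \exists (F,k)\in W,\ F\subseteq Y\}$; a partial function $e$ is enumeration reducible to a partial function $d$ if $\mathrm{gra}(e)=W^{\mathrm{gra}(d)}$ for some enumeration operator $W$. $h\le_{\mathrm{ng}} g$ means every generic description $d$ of $g$ has a generic description $e$ of $h$ enumeration reducible to $d$; $h\le_{\mathrm{ug}} g$ means there is a single enumeration operator $W$ such that for every generic description $d$ of $g$, $W^{\mathrm{gra}(d)}$ is the graph of a generic description of $h$. Sets are identified with their characteristic functions. *)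

theory Defs
  imports "HOL-Probability.Probability" "HOL-Library.Nat_Bijection"
begin

section \<open>Partial recursive functions relative to an oracle\<close>

text \<open>
  Kleene's schemes for the partial recursive functions, with one extra initial function that
  queries the oracle.  Arities are not recorded in the syntax: a program run on an argument list
  that is too short is undefined, and surplus arguments are ignored by the initial functions.
\<close>

datatype prog =
    Zero
  | Succ
  | Proj nat
  | Oracle
  | Comp prog "prog list"
  | PrimRec prog prog
  | Mu prog

fun eval :: "prog \<Rightarrow> (nat \<Rightarrow> nat) \<Rightarrow> nat list \<Rightarrow> nat option" where
  "eval Zero g xs = Some 0"
| "eval Succ g xs = (case xs of [] \<Rightarrow> None | x # _ \<Rightarrow> Some (Suc x))"
| "eval (Proj i) g xs = (if i < length xs then Some (xs ! i) else None)"
| "eval Oracle g xs = (case xs of [] \<Rightarrow> None | x # _ \<Rightarrow> Some (g x))"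
| "eval (Comp p qs) g xs = Option.bind (those (map (\<lambda>q. eval q g xs) qs)) (eval p g)"
| "eval (PrimRec p q) g xs =
     (case xs of
        [] \<Rightarrow> None
      | n # ys \<Rightarrow>
          rec_nat (eval p g ys) (\<lambda>m r. Option.bind r (\<lambda>y. eval q g (m # y # ys))) n)"
| "eval (Mu p) g xs =
     (if \<exists>n. eval p g (n # xs) = Some 0 \<and> (\<forall>m<n. eval p g (m # xs) \<noteq> None)
      then Some (LEAST n. eval p g (n # xs) = Some 0)
      else None)"

abbreviation char_fun :: "nat set \<Rightarrow> nat \<Rightarrow> nat" where
  "char_fun A \<equiv> indicator A"

definition partial_computable_in :: "(nat \<Rightarrow> nat) \<Rightarrow> (nat \<rightharpoonup> nat) \<Rightarrow> bool" where
  "partial_computable_in g d \<longleftrightarrow> (\<exists>p. \<forall>n. d n = eval p g [n])"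

definition partial_computable :: "(nat \<rightharpoonup> nat) \<Rightarrow> bool" where
  "partial_computable d \<longleftrightarrow> partial_computable_in (char_fun {}) d"

definition ce :: "nat set \<Rightarrow> bool" where
  "ce S \<longleftrightarrow> (\<exists>d. partial_computable d \<and> S = dom d)"


section \<open>Generic computability\<close>

definition has_density :: "nat set \<Rightarrow> real \<Rightarrow> bool" where
  "has_density A r \<longleftrightarrow> (\<lambda>n. real (card (A \<inter> {0..<n})) / real n) \<longlonglongrightarrow> r"

definition generic_description :: "(nat \<rightharpoonup> nat) \<Rightarrow> (nat \<Rightarrow> nat) \<Rightarrow> bool" where
  "generic_description d g \<longleftrightarrow> (\<forall>n\<in>dom d. d n = Some (g n)) \<and> has_density (dom d) 1"

definition generically_computable :: "(nat \<Rightarrow> nat) \<Rightarrow> bool" where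
  "generically_computable g \<longleftrightarrow> (\<exists>d. partial_computable d \<and> generic_description d g)"

definition generically_computable_in :: "nat set \<Rightarrow> (nat \<Rightarrow> nat) \<Rightarrow> bool" where
  "generically_computable_in X g \<longleftrightarrow>
     (\<exists>d. partial_computable_in (char_fun X) d \<and> generic_description d g)"


section \<open>Enumeration reducibility and generic reducibilities\<close>

text \<open>A set of pairs \<open>(F, k)\<close> is coded through canonical indices of finite sets.\<close>

definition enumeration_operator :: "(nat set \<times> nat) set \<Rightarrow> bool" where
  "enumeration_operator W \<longleftrightarrow>
     (\<forall>(F, k)\<in>W. finite F) \<and> ce ((\<lambda>(F, k). prod_encode (set_encode F, k)) ` W)"

definition enum_apply :: "(nat set \<times> nat) set \<Rightarrow> nat set \<Rightarrow> nat set" where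
  "enum_apply W Y = {k. \<exists>F. (F, k) \<in> W \<and> F \<subseteq> Y}"

definition gra :: "(nat \<rightharpoonup> nat) \<Rightarrow> nat set" where
  "gra d = {prod_encode (n, m) |n m. d n = Some m}"

definition enum_reducible :: "(nat \<rightharpoonup> nat) \<Rightarrow> (nat \<rightharpoonup> nat) \<Rightarrow> bool" where
  "enum_reducible e d \<longleftrightarrow> (\<exists>W. enumeration_operator W \<and> gra e = enum_apply W (gra d))"

definition ng_reducible :: "(nat \<Rightarrow> nat) \<Rightarrow> (nat \<Rightarrow> nat) \<Rightarrow> bool" (infix "\<le>\<^sub>n\<^sub>g" 50) where
  "h \<le>\<^sub>n\<^sub>g g \<longleftrightarrow>
     (\<forall>d. generic_description d g \<longrightarrow> (\<exists>e. generic_description e h \<and> enum_reducible e d))"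

definition ug_reducible :: "(nat \<Rightarrow> nat) \<Rightarrow> (nat \<Rightarrow> nat) \<Rightarrow> bool" (infix "\<le>\<^sub>u\<^sub>g" 50) where
  "h \<le>\<^sub>u\<^sub>g g \<longleftrightarrow>
     (\<exists>W. enumeration_operator W \<and>
        (\<forall>d. generic_description d g \<longrightarrow>
           (\<exists>e. generic_description e h \<and> enum_apply W (gra d) = gra e)))"


section \<open>Measure and randomness on Cantor space\<close>

text \<open>
  The fair-coin measure on characteristic sequences, transported to subsets of \<open>\<nat>\<close> along the
  bijection \<open>Collect\<close>.  The completion matters: \<open>{X. A \<le>\<^sub>n\<^sub>g X}\<close> need not be Borel, and being
  null has to be expressed by membership in \<open>null_sets\<close>, because \<open>emeasure\<close> is \<open>0\<close> by
  convention on non-measurable sets.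
\<close>

definition cantor_measure :: "nat set measure" where
  "cantor_measure =
     completion (embed_measure (\<Pi>\<^sub>M i\<in>UNIV. measure_pmf (bernoulli_pmf (1 / 2))) Collect)"

definition oracle_join :: "(nat \<Rightarrow> nat) \<Rightarrow> (nat \<Rightarrow> nat) \<Rightarrow> nat \<Rightarrow> nat" where
  "oracle_join g h n = (if even n then g (n div 2) else h (n div 2))"

fun pi_form :: "nat \<Rightarrow> (nat list \<Rightarrow> bool) \<Rightarrow> bool"
  and sigma_form :: "nat \<Rightarrow> (nat list \<Rightarrow> bool) \<Rightarrow> bool" where
  "pi_form 0 P \<longleftrightarrow> P []"
| "pi_form (Suc n) P \<longleftrightarrow> (\<forall>m. sigma_form n (\<lambda>ms. P (m # ms)))"
| "sigma_form 0 P \<longleftrightarrow> P []"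
| "sigma_form (Suc n) P \<longleftrightarrow> (\<exists>m. pi_form n (\<lambda>ms. P (m # ms)))"

text \<open>
  The \<open>\<Pi>\<^sup>0\<^sub>n\<close> classes relative to \<open>Z\<close> are those of the form
  \<open>{X. \<forall>m\<^sub>1 \<exists>m\<^sub>2 \<dots> R X [m\<^sub>1, \<dots>, m\<^sub>n]}\<close> with \<open>n\<close> alternating quantifiers, where a single program
  decides \<open>R\<close> from the oracle \<open>X \<oplus> Z\<close>, for all \<open>X\<close>.
\<close>

definition pi_class :: "nat \<Rightarrow> (nat \<Rightarrow> nat) \<Rightarrow> nat set set \<Rightarrow> bool" where
  "pi_class n Z C \<longleftrightarrow>
     (\<exists>p R. (\<forall>X ms. length ms = n \<longrightarrow>
                eval p (oracle_join (char_fun X) Z) ms = Some (of_bool (R X ms))) \<and>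
            C = {X. pi_form n (R X)})"

definition weakly_random :: "nat \<Rightarrow> (nat \<Rightarrow> nat) \<Rightarrow> nat set \<Rightarrow> bool" where
  "weakly_random n Z X \<longleftrightarrow>
     \<not> (\<exists>C. pi_class n Z C \<and> C \<in> null_sets cantor_measure \<and> X \<in> C)"

end

theory Submission
  imports Defs
begin

text \<open>
  For a fixed program \<open>p\<close>, the class of oracles from which \<open>p\<close> computes a generic description of
  \<open>f\<close> is \<open>\<Pi>\<^sub>4\<close> relative to \<open>f\<close>: convergence is \<open>\<Sigma>\<^sub>1\<close> and density one adds the prefix \<open>\<forall>\<exists>\<forall>\<close>.
  If this class had positive measure, it would fill more than half of some cylinder.  On input \<open>n\<close>,
  search for a value that \<open>p\<close> outputs on more than half of the oracles in that cylinder.  Such a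
  value is output by some oracle of the class, hence correct, and an averaging argument shows that
  the search succeeds on a set of inputs of density one; so \<open>f\<close> is generically computable.
  Taking the union over the countably many programs gives the null class.  Finally, a total
  description of \<open>X\<close> is enumerable from \<open>X\<close>, so both reducibilities to \<open>X\<close> imply generic
  computability relative to \<open>X\<close>.
\<close>

section \<open>Evaluation with bounded resources\<close>

text \<open>
  The bound \<open>s\<close> limits both unbounded searches and oracle queries, so that a run with bound \<open>s\<close>
  only sees the oracle below \<open>s\<close>.
\<close>

fun eval_within :: "prog \<Rightarrow> (nat \<Rightarrow> nat) \<Rightarrow> nat \<Rightarrow> nat list \<Rightarrow> nat option" where
  "eval_within Zero g s xs = Some 0"
| "eval_within Succ g s xs = (case xs of [] \<Rightarrow> None | x # _ \<Rightarrow> Some (Suc x))"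
| "eval_within (Proj i) g s xs = (if i < length xs then Some (xs ! i) else None)"
| "eval_within Oracle g s xs = (case xs of [] \<Rightarrow> None | x # _ \<Rightarrow> if x < s then Some (g x) else None)"
| "eval_within (Comp p qs) g s xs = Option.bind (those (map (\<lambda>q. eval_within q g s xs) qs)) (eval_within p g s)"
| "eval_within (PrimRec p q) g s xs =
     (case xs of
        [] \<Rightarrow> None
      | n # ys \<Rightarrow>
          rec_nat (eval_within p g s ys) (\<lambda>m r. Option.bind r (\<lambda>y. eval_within q g s (m # y # ys))) n)"
| "eval_within (Mu p) g s xs =
     (if \<exists>n<s. eval_within p g s (n # xs) = Some 0 \<and> (\<forall>m<n. eval_within p g s (m # xs) \<noteq> None)
      then Some (LEAST n. eval_within p g s (n # xs) = Some 0)
      else None)"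

lemma those_map_eq_Some_iff:
  "those (map f qs) = Some vs \<longleftrightarrow> length vs = length qs \<and> (\<forall>i<length qs. f (qs ! i) = Some (vs ! i))"
proof (induction qs arbitrary: vs)
  case Nil
  then show ?case by auto
next
  case (Cons q qs)
  show ?case
  proof (cases vs)
    case Nil
    then show ?thesis by (auto split: option.splits)
  next
    case (Cons w ws)
    have "those (map f (q # qs)) = Some vs \<longleftrightarrow> f q = Some w \<and> those (map f qs) = Some ws"
      using Cons by (auto split: option.splits)
    also have "\<dots> \<longleftrightarrow> length vs = length (q # qs) \<and> (\<forall>i<length (q # qs). f ((q # qs) ! i) = Some (vs ! i))"
      unfolding Cons.IH using Cons by (auto simp: nth_Cons split: nat.splits)
    finally show ?thesis .
  qed
qed

lemma Mu_search_cong: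
  fixes P Q :: "nat \<Rightarrow> nat option"
  assumes "P n = Some 0" "\<forall>m<n. P m \<noteq> None"
    and imp: "\<And>m v. m \<le> n \<Longrightarrow> P m = Some v \<Longrightarrow> Q m = Some v"
  shows "\<exists>k\<le>n. Q k = Some 0 \<and> (\<forall>m<k. Q m \<noteq> None) \<and> (LEAST n. P n = Some 0) = k
          \<and> (LEAST n. Q n = Some 0) = k"
proof -
  define k where "k = (LEAST n. P n = Some 0)"
  have Pk: "P k = Some 0" unfolding k_def using assms(1) by (rule LeastI)
  have kn: "k \<le> n" unfolding k_def using assms(1) by (rule Least_le)
  have lt: "P m \<noteq> Some 0" if "m < k" for m using that not_less_Least unfolding k_def by blast
  have Qlt: "Q m \<noteq> None \<and> Q m \<noteq> Some 0" if "m < k" for m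
  proof -
    have "m < n" using that kn by simp
    then obtain v where v: "P m = Some v" using assms(2) by auto
    with lt[OF that] imp[of m v] \<open>m < n\<close> show ?thesis by auto
  qed
  have "Q k = Some 0" using imp Pk kn by blast
  moreover have "(LEAST n. Q n = Some 0) = k"
    using \<open>Q k = Some 0\<close> Qlt by (intro Least_equality) (auto simp: not_less[symmetric])
  ultimately show ?thesis using Qlt kn by (intro exI[of _ k]) (simp add: k_def[symmetric])
qed

lemma eval_within_mono:
  assumes "eval_within p g s xs = Some v" "s \<le> t"
  shows "eval_within p g t xs = Some v"
  using assms(1)
proof (induction p arbitrary: xs v)
  case (Comp p qs)
  then obtain vs where vs: "those (map (\<lambda>q. eval_within q g s xs) qs) = Some vs" "eval_within p g s vs = Some v"
    by (auto simp: bind_eq_Some_conv)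
  have "those (map (\<lambda>q. eval_within q g t xs) qs) = Some vs"
    using vs(1) Comp.IH(2) unfolding those_map_eq_Some_iff by auto
  with Comp.IH(1)[OF vs(2)] show ?case by simp
next
  case (PrimRec p q)
  then obtain n ys where xs: "xs = n # ys" by (cases xs) auto
  have "rec_nat (eval_within p g s ys) (\<lambda>m r. Option.bind r (\<lambda>y. eval_within q g s (m # y # ys))) n = Some v \<Longrightarrow>
     rec_nat (eval_within p g t ys) (\<lambda>m r. Option.bind r (\<lambda>y. eval_within q g t (m # y # ys))) n = Some v" for v
    by (induction n arbitrary: v) (auto simp: bind_eq_Some_conv intro: PrimRec.IH)
  with PrimRec.prems show ?case by (simp add: xs)
next
  case (Mu p)
  then obtain n where n: "n < s" "eval_within p g s (n # xs) = Some 0" "\<forall>m<n. eval_within p g s (m # xs) \<noteq> None"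
    and v: "v = (LEAST n. eval_within p g s (n # xs) = Some 0)"
    by (auto split: if_splits)
  from Mu_search_cong[of "\<lambda>n. eval_within p g s (n # xs)" n "\<lambda>n. eval_within p g t (n # xs)", OF n(2,3) Mu.IH]
  obtain k where "k \<le> n" "eval_within p g t (k # xs) = Some 0" "\<forall>m<k. eval_within p g t (m # xs) \<noteq> None"
     "v = k" "(LEAST n. eval_within p g t (n # xs) = Some 0) = k" unfolding v by blast
  moreover from this have "k < t" using n(1) assms(2) by linarith
  ultimately show ?case by auto
qed (use assms(2) in \<open>auto split: list.splits if_splits\<close>)

lemma eval_within_sound:
  assumes "eval_within p g s xs = Some v"
  shows "eval p g xs = Some v"
  using assms
proof (induction p arbitrary: xs v)
  case (Comp p qs)
  then obtain vs where vs: "those (map (\<lambda>q. eval_within q g s xs) qs) = Some vs" "eval_within p g s vs = Some v"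
    by (auto simp: bind_eq_Some_conv)
  have "those (map (\<lambda>q. eval q g xs) qs) = Some vs"
    using vs(1) Comp.IH(2) unfolding those_map_eq_Some_iff by auto
  with Comp.IH(1)[OF vs(2)] show ?case by simp
next
  case (PrimRec p q)
  then obtain n ys where xs: "xs = n # ys" by (cases xs) auto
  have "rec_nat (eval_within p g s ys) (\<lambda>m r. Option.bind r (\<lambda>y. eval_within q g s (m # y # ys))) n = Some v \<Longrightarrow>
     rec_nat (eval p g ys) (\<lambda>m r. Option.bind r (\<lambda>y. eval q g (m # y # ys))) n = Some v" for v
    by (induction n arbitrary: v) (auto simp: bind_eq_Some_conv intro: PrimRec.IH)
  with PrimRec.prems show ?case by (simp add: xs)
next
  case (Mu p)
  then obtain n where n: "n < s" "eval_within p g s (n # xs) = Some 0" "\<forall>m<n. eval_within p g s (m # xs) \<noteq> None"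
    and v: "v = (LEAST n. eval_within p g s (n # xs) = Some 0)"
    by (auto split: if_splits)
  from Mu_search_cong[of "\<lambda>n. eval_within p g s (n # xs)" n "\<lambda>n. eval p g (n # xs)", OF n(2,3) Mu.IH]
  obtain k where "k \<le> n" "eval p g (k # xs) = Some 0" "\<forall>m<k. eval p g (m # xs) \<noteq> None"
     "v = k" "(LEAST n. eval p g (n # xs) = Some 0) = k" unfolding v by blast
  then show ?case by auto
qed (auto split: list.splits if_splits)

lemma eval_within_uniform:
  fixes n :: nat
  shows "\<exists>s. \<forall>i<n. (\<exists>r. eval_within (P i) g r (Y i) \<noteq> None) \<longrightarrow> eval_within (P i) g s (Y i) \<noteq> None"
proof -
  define S where "S i = (SOME r. eval_within (P i) g r (Y i) \<noteq> None)" for i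
  have S: "eval_within (P i) g (S i) (Y i) \<noteq> None" if "\<exists>r. eval_within (P i) g r (Y i) \<noteq> None" for i
    unfolding S_def using that by (rule someI_ex)
  have "eval_within (P i) g (\<Sum>j<n. S j) (Y i) \<noteq> None" if "i < n" "\<exists>r. eval_within (P i) g r (Y i) \<noteq> None" for i
  proof -
    have "S i \<le> (\<Sum>j<n. S j)" using that(1) by (intro member_le_sum) auto
    with S[OF that(2)] eval_within_mono show ?thesis by (metis not_None_eq)
  qed
  then show ?thesis by blast
qed

lemma eval_within_complete:
  assumes "eval p g xs = Some v"
  shows "\<exists>s. eval_within p g s xs = Some v"
  using assms
proof (induction p arbitrary: xs v)
  case Oracle
  then obtain x ys where "xs = x # ys" by (cases xs) auto
  with Oracle show ?case by (intro exI[of _ "Suc x"]) auto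
next
  case (Comp p qs)
  then obtain vs where vs: "those (map (\<lambda>q. eval q g xs) qs) = Some vs" "eval p g vs = Some v"
    by (auto simp: bind_eq_Some_conv)
  have "\<forall>i<length qs. \<exists>s. eval_within (qs ! i) g s xs \<noteq> None"
    using vs(1) Comp.IH(2) unfolding those_map_eq_Some_iff by (metis nth_mem option.distinct(1))
  with eval_within_uniform[of "length qs" "(!) qs" g "\<lambda>_. xs"]
  obtain s1 where "\<forall>i<length qs. eval_within (qs ! i) g s1 xs \<noteq> None" by auto
  then have s1: "\<forall>i<length qs. \<exists>v. eval_within (qs ! i) g s1 xs = Some v" by simp
  obtain s2 where s2: "eval_within p g s2 vs = Some v" using Comp.IH(1)[OF vs(2)] by blast
  have "\<forall>i<length qs. eval_within (qs ! i) g (max s1 s2) xs = Some (vs ! i)"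
    using vs(1) s1 eval_within_sound eval_within_mono[of _ g s1 xs _ "max s1 s2"]
    unfolding those_map_eq_Some_iff by (metis max.cobounded1)
  then have "those (map (\<lambda>q. eval_within q g (max s1 s2) xs) qs) = Some vs"
    using vs(1) unfolding those_map_eq_Some_iff by auto
  with eval_within_mono[OF s2, of "max s1 s2"] show ?case by (intro exI[of _ "max s1 s2"]) simp
next
  case (PrimRec p q)
  then obtain n ys where xs: "xs = n # ys" by (cases xs) auto
  have "rec_nat (eval p g ys) (\<lambda>m r. Option.bind r (\<lambda>y. eval q g (m # y # ys))) n = Some v \<Longrightarrow>
     \<exists>s. eval_within (PrimRec p q) g s (n # ys) = Some v" for v
  proof (induction n arbitrary: v)
    case 0
    then show ?case using PrimRec.IH(1) by auto
  next
    case (Suc n)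
    then obtain y where y: "rec_nat (eval p g ys) (\<lambda>m r. Option.bind r (\<lambda>y. eval q g (m # y # ys))) n = Some y"
       "eval q g (n # y # ys) = Some v" by (auto simp: bind_eq_Some_conv)
    obtain s1 where s1: "eval_within (PrimRec p q) g s1 (n # ys) = Some y" using Suc.IH[OF y(1)] by blast
    obtain s2 where s2: "eval_within q g s2 (n # y # ys) = Some v" using PrimRec.IH(2)[OF y(2)] by blast
    have "eval_within (PrimRec p q) g (max s1 s2) (n # ys) = Some y" "eval_within q g (max s1 s2) (n # y # ys) = Some v"
      using eval_within_mono s1 s2 by (meson max.cobounded1 max.cobounded2)+
    then show ?case by (intro exI[of _ "max s1 s2"]) simp
  qed
  with PrimRec.prems show ?case by (simp add: xs)
next
  case (Mu p)
  then obtain n where n: "eval p g (n # xs) = Some 0" "\<forall>m<n. eval p g (m # xs) \<noteq> None"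
    and v: "v = (LEAST n. eval p g (n # xs) = Some 0)"
    by (auto split: if_splits)
  have "\<forall>i<Suc n. \<exists>s. eval_within p g s (i # xs) \<noteq> None"
    using n Mu.IH by (metis less_Suc_eq not_None_eq)
  with eval_within_uniform[of "Suc n" "\<lambda>_. p" g "\<lambda>i. i # xs"]
  obtain s where "\<forall>i<Suc n. eval_within p g s (i # xs) \<noteq> None" by auto
  then have s: "\<forall>i<Suc n. \<exists>v. eval_within p g s (i # xs) = Some v" by simp
  define t where "t = max s (Suc n)"
  have "eval_within p g t (m # xs) = Some w" if m: "m \<le> n" "eval p g (m # xs) = Some w" for m w
  proof -
    obtain w' where "eval_within p g s (m # xs) = Some w'" using s m(1) le_imp_less_Suc by blast
    then have "eval_within p g t (m # xs) = Some w'" by (rule eval_within_mono) (simp add: t_def)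
    with eval_within_sound[OF this] m(2) show ?thesis by simp
  qed
  from Mu_search_cong[of "\<lambda>n. eval p g (n # xs)" n "\<lambda>n. eval_within p g t (n # xs)", OF n this]
  obtain k where "k \<le> n" "eval_within p g t (k # xs) = Some 0" "\<forall>m<k. eval_within p g t (m # xs) \<noteq> None"
     "v = k" "(LEAST n. eval_within p g t (n # xs) = Some 0) = k" unfolding v by blast
  moreover from this have "k < t" by (simp add: t_def)
  ultimately show ?case by (intro exI[of _ t]) auto
qed auto

lemma eval_eq_Some_iff_eval_within: "eval p g xs = Some v \<longleftrightarrow> (\<exists>s. eval_within p g s xs = Some v)"
  using eval_within_sound eval_within_complete by blast

lemma eval_defined_iff_eval_within: "eval p g xs \<noteq> None \<longleftrightarrow> (\<exists>s. eval_within p g s xs \<noteq> None)"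
  by (metis eval_eq_Some_iff_eval_within not_None_eq)

lemma eval_within_use:
  assumes "\<forall>i<s. g i = h i"
  shows "eval_within p g s xs = eval_within p h s xs"
proof (induction p arbitrary: xs)
  case (Comp p qs)
  then have "map (\<lambda>q. eval_within q g s xs) qs = map (\<lambda>q. eval_within q h s xs) qs" by simp
  moreover have "eval_within p g s = eval_within p h s" using Comp.IH(1) by blast
  ultimately show ?case by (simp del: map_eq_conv)
qed (use assms in \<open>auto split: list.splits\<close>)


section \<open>Total recursive functionals\<close>

definition recursive :: "nat \<Rightarrow> ((nat \<Rightarrow> nat) \<Rightarrow> nat list \<Rightarrow> nat) \<Rightarrow> bool" where
  "recursive k F \<longleftrightarrow> (\<exists>t. \<forall>g xs. length xs = k \<longrightarrow> eval t g xs = Some (F g xs))"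

definition decidable :: "nat \<Rightarrow> ((nat \<Rightarrow> nat) \<Rightarrow> nat list \<Rightarrow> bool) \<Rightarrow> bool" where
  "decidable k P \<longleftrightarrow> recursive k (\<lambda>g xs. of_bool (P g xs))"

lemma recursive_cong:
  assumes "recursive k F" "\<And>g xs. length xs = k \<Longrightarrow> F g xs = G g xs"
  shows "recursive k G"
  using assms unfolding recursive_def by metis

lemma recursive_nth: "i < k \<Longrightarrow> recursive k (\<lambda>g xs. xs ! i)"
  unfolding recursive_def by (intro exI[of _ "Proj i"]) simp

lemma recursive_nth_drop: "j + i < k \<Longrightarrow> recursive k (\<lambda>g xs. drop j xs ! i)"
  by (rule recursive_cong[OF recursive_nth[of "j + i"]]) auto

lemma recursive_nth_drop2: "i + (j + l) < k \<Longrightarrow> recursive k (\<lambda>g xs. drop i (drop j xs) ! l)"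
  by (rule recursive_cong[OF recursive_nth[of "i + (j + l)"]]) (auto simp: ac_simps)

lemma recursive_nth_drop3: "i + (j + (m + l)) < k \<Longrightarrow> recursive k (\<lambda>g xs. drop i (drop j (drop m xs)) ! l)"
  by (rule recursive_cong[OF recursive_nth[of "i + (j + (m + l))"]]) (auto simp: ac_simps)

lemma recursive_map:
  assumes F: "recursive m F" and len: "length As = m" and A: "\<forall>A\<in>set As. recursive k A"
  shows "recursive k (\<lambda>g xs. F g (map (\<lambda>A. A g xs) As))"
proof -
  obtain t where t: "\<And>g xs. length xs = m \<Longrightarrow> eval t g xs = Some (F g xs)"
    using F unfolding recursive_def by blast
  obtain T where T: "\<And>A g xs. A \<in> set As \<Longrightarrow> length xs = k \<Longrightarrow> eval (T A) g xs = Some (A g xs)"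
    using A unfolding recursive_def by metis
  have "eval (Comp t (map T As)) g xs = Some (F g (map (\<lambda>A. A g xs) As))" if "length xs = k" for g xs
  proof -
    have "those (map (\<lambda>q. eval q g xs) (map T As)) = Some (map (\<lambda>A. A g xs) As)"
      unfolding those_map_eq_Some_iff using T that by simp
    then show ?thesis using t[of "map (\<lambda>A. A g xs) As" g] len by simp
  qed
  then show ?thesis unfolding recursive_def by blast
qed

lemma recursive_comp1:
  assumes "recursive 1 (\<lambda>g xs. F g (xs ! 0))" "recursive k A"
  shows "recursive k (\<lambda>g xs. F g (A g xs))"
  using recursive_map[OF assms(1), of "[A]" k] assms(2) by simp

lemma recursive_comp2:
  assumes "recursive 2 (\<lambda>g xs. F g (xs ! 0) (xs ! 1))" "recursive k A" "recursive k B"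
  shows "recursive k (\<lambda>g xs. F g (A g xs) (B g xs))"
  using recursive_map[OF assms(1), of "[A, B]" k] assms(2,3) by fastforce

lemma recursive_Suc: "recursive k A \<Longrightarrow> recursive k (\<lambda>g xs. Suc (A g xs))"
  by (rule recursive_comp1[where F = "\<lambda>_. Suc"])
    (auto simp: recursive_def length_Suc_conv intro!: exI[of _ Succ])

lemma recursive_oracle: "recursive k A \<Longrightarrow> recursive k (\<lambda>g xs. g (A g xs))"
  by (rule recursive_comp1[where F = "\<lambda>g. g"])
    (auto simp: recursive_def length_Suc_conv intro!: exI[of _ Oracle])

lemma recursive_const: "recursive k (\<lambda>g xs. n)"
proof (induction n)
  case 0
  show ?case unfolding recursive_def by (intro exI[of _ Zero]) simp
qed (rule recursive_Suc)

lemma recursive_primrec: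
  assumes B: "recursive k B" and S: "recursive (Suc (Suc k)) (\<lambda>g ys. S g (ys ! 0) (ys ! 1) (drop 2 ys))"
    and A: "recursive k A"
  shows "recursive k (\<lambda>g xs. rec_nat (B g xs) (\<lambda>m r. S g m r xs) (A g xs))"
proof -
  obtain b where b: "\<And>g xs. length xs = k \<Longrightarrow> eval b g xs = Some (B g xs)"
    using B unfolding recursive_def by blast
  obtain s where s: "\<And>g xs. length xs = Suc (Suc k) \<Longrightarrow> eval s g xs = Some (S g (xs ! 0) (xs ! 1) (drop 2 xs))"
    using S unfolding recursive_def by blast
  have *: "rec_nat (eval b g xs) (\<lambda>m r. Option.bind r (\<lambda>y. eval s g (m # y # xs))) n
     = Some (rec_nat (B g xs) (\<lambda>m r. S g m r xs) n)" if "length xs = k" for g xs n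
    using that by (induction n) (simp_all add: b s)
  have "recursive (Suc k) (\<lambda>g ys. rec_nat (B g (drop 1 ys)) (\<lambda>m r. S g m r (drop 1 ys)) (ys ! 0))"
    unfolding recursive_def
    by (intro exI[of _ "PrimRec b s"]) (auto simp: length_Suc_conv *)
  from recursive_map[OF this, of "A # map (\<lambda>i g xs. xs ! i) [0..<k]" k]
  have "recursive k (\<lambda>g xs. rec_nat (B g (map (\<lambda>i. xs ! i) [0..<k])) (\<lambda>m r. S g m r (map (\<lambda>i. xs ! i) [0..<k])) (A g xs))"
    using A by (auto simp: recursive_nth comp_def)
  then show ?thesis by (rule recursive_cong) (auto simp: map_nth)
qed

lemma recursive_add: "recursive k A \<Longrightarrow> recursive k B \<Longrightarrow> recursive k (\<lambda>g xs. A g xs + B g xs)"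
proof (rule recursive_comp2[where F = "\<lambda>_. (+)"])
  have "recursive 2 (\<lambda>g xs. rec_nat (xs ! 0) (\<lambda>m r. Suc r) (xs ! 1))"
    by (intro recursive_primrec recursive_Suc recursive_nth) auto
  moreover have "rec_nat a (\<lambda>m r. Suc r) b = a + b" for a b by (induction b) auto
  ultimately show "recursive 2 (\<lambda>g xs. xs ! 0 + xs ! 1)" by simp
qed

lemma recursive_mult: "recursive k A \<Longrightarrow> recursive k B \<Longrightarrow> recursive k (\<lambda>g xs. A g xs * B g xs)"
proof (rule recursive_comp2[where F = "\<lambda>_. (*)"])
  have "recursive 2 (\<lambda>g xs. rec_nat 0 (\<lambda>m r. r + xs ! 0) (xs ! 1))"
    by (intro recursive_primrec recursive_add recursive_const recursive_nth recursive_nth_drop) auto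
  moreover have "rec_nat 0 (\<lambda>m r. r + a) b = a * b" for a b :: nat by (induction b) auto
  ultimately show "recursive 2 (\<lambda>g xs. xs ! 0 * xs ! 1)" by simp
qed

lemma recursive_power: "recursive k A \<Longrightarrow> recursive k B \<Longrightarrow> recursive k (\<lambda>g xs. A g xs ^ B g xs)"
proof (rule recursive_comp2[where F = "\<lambda>_. (^)"])
  have "recursive 2 (\<lambda>g xs. rec_nat 1 (\<lambda>m r. xs ! 0 * r) (xs ! 1))"
    by (intro recursive_primrec recursive_mult recursive_const recursive_nth recursive_nth_drop) auto
  moreover have "rec_nat 1 (\<lambda>m r. a * r) b = a ^ b" for a b :: nat by (induction b) auto
  ultimately show "recursive 2 (\<lambda>g xs. xs ! 0 ^ xs ! 1)" by simp
qed

lemma recursive_pred: "recursive k A \<Longrightarrow> recursive k (\<lambda>g xs. A g xs - 1)"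
proof (rule recursive_comp1[where F = "\<lambda>_ n. n - 1"])
  have "recursive 1 (\<lambda>g xs. rec_nat 0 (\<lambda>m r. m) (xs ! 0))"
    by (intro recursive_primrec recursive_const recursive_nth) auto
  moreover have "rec_nat 0 (\<lambda>m r. m) a = a - 1" for a :: nat by (cases a) auto
  ultimately show "recursive 1 (\<lambda>g xs. xs ! 0 - 1)" by simp
qed

lemma recursive_diff: "recursive k A \<Longrightarrow> recursive k B \<Longrightarrow> recursive k (\<lambda>g xs. A g xs - B g xs)"
proof (rule recursive_comp2[where F = "\<lambda>_. (-)"])
  have "recursive 2 (\<lambda>g xs. rec_nat (xs ! 0) (\<lambda>m r. r - 1) (xs ! 1))"
    by (intro recursive_primrec recursive_pred recursive_nth) auto
  moreover have "rec_nat a (\<lambda>m r. r - 1) b = a - b" for a b :: nat by (induction b) auto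
  ultimately show "recursive 2 (\<lambda>g xs. xs ! 0 - xs ! 1)" by simp
qed

lemma recursive_sum:
  assumes "recursive (Suc k) (\<lambda>g ys. B g (ys ! 0) (drop 1 ys))" "recursive k A"
  shows "recursive k (\<lambda>g xs. \<Sum>m<A g xs. B g m xs)"
proof -
  have "recursive (Suc (Suc k)) (\<lambda>g ys. B g (ys ! 0) (drop 2 ys))"
  proof (rule recursive_cong)
    show "recursive (Suc (Suc k)) (\<lambda>g ys. B g (map (\<lambda>i. ys ! i) (0 # [2..<Suc (Suc k)]) ! 0)
            (drop 1 (map (\<lambda>i. ys ! i) (0 # [2..<Suc (Suc k)]))))"
      using recursive_map[OF assms(1), of "map (\<lambda>i g xs. xs ! i) (0 # [2..<Suc (Suc k)])" "Suc (Suc k)"]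
      by (auto simp: comp_def recursive_nth simp del: upt_Suc)
    fix g and ys :: "nat list" assume "length ys = Suc (Suc k)"
    then have "map (\<lambda>i. ys ! i) [2..<Suc (Suc k)] = drop 2 ys"
      by (intro nth_equalityI) (auto simp del: upt_Suc)
    then show "B g (map (\<lambda>i. ys ! i) (0 # [2..<Suc (Suc k)]) ! 0)
            (drop 1 (map (\<lambda>i. ys ! i) (0 # [2..<Suc (Suc k)]))) = B g (ys ! 0) (drop 2 ys)"
      by (simp del: upt_Suc)
  qed
  then have "recursive k (\<lambda>g xs. rec_nat 0 (\<lambda>m r. r + B g m xs) (A g xs))"
    using assms(2) by (intro recursive_primrec recursive_add recursive_const) (auto intro: recursive_nth)
  moreover have "rec_nat 0 (\<lambda>m r. r + f m) n = (\<Sum>m<n. f m)" for f :: "nat \<Rightarrow> nat" and n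
    by (induction n) auto
  ultimately show ?thesis by simp
qed

lemma recursive_of_bool: "decidable k P \<Longrightarrow> recursive k (\<lambda>g xs. of_bool (P g xs))"
  by (simp add: decidable_def)

lemma decidable_cong:
  assumes "decidable k P" "\<And>g xs. length xs = k \<Longrightarrow> P g xs = Q g xs"
  shows "decidable k Q"
  using assms(1) unfolding decidable_def by (rule recursive_cong) (simp add: assms(2))

lemma decidable_le: "recursive k A \<Longrightarrow> recursive k B \<Longrightarrow> decidable k (\<lambda>g xs. A g xs \<le> B g xs)"
  unfolding decidable_def
  by (rule recursive_cong[of _ "\<lambda>g xs. 1 - (A g xs - B g xs)"]) (intro recursive_diff recursive_const, auto)

lemma decidable_conj: "decidable k P \<Longrightarrow> decidable k Q \<Longrightarrow> decidable k (\<lambda>g xs. P g xs \<and> Q g xs)"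
  unfolding decidable_def of_bool_conj by (rule recursive_mult)

lemma decidable_not: "decidable k P \<Longrightarrow> decidable k (\<lambda>g xs. \<not> P g xs)"
  unfolding decidable_def
  by (rule recursive_cong[of _ "\<lambda>g xs. 1 - of_bool (P g xs)"]) (intro recursive_diff recursive_const, auto)

lemma decidable_imp: "decidable k P \<Longrightarrow> decidable k Q \<Longrightarrow> decidable k (\<lambda>g xs. P g xs \<longrightarrow> Q g xs)"
  by (rule decidable_cong[of _ "\<lambda>g xs. \<not> (P g xs \<and> \<not> Q g xs)"]) (intro decidable_conj decidable_not, auto)

lemma decidable_disj: "decidable k P \<Longrightarrow> decidable k Q \<Longrightarrow> decidable k (\<lambda>g xs. P g xs \<or> Q g xs)"
  by (rule decidable_cong[of _ "\<lambda>g xs. \<not> (\<not> P g xs \<and> \<not> Q g xs)"]) (intro decidable_conj decidable_not, auto)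

lemma decidable_eq: "recursive k A \<Longrightarrow> recursive k B \<Longrightarrow> decidable k (\<lambda>g xs. A g xs = B g xs)"
  unfolding eq_iff[where 'a = nat] by (intro decidable_conj decidable_le)

lemma decidable_less: "recursive k A \<Longrightarrow> recursive k B \<Longrightarrow> decidable k (\<lambda>g xs. A g xs < B g xs)"
  unfolding not_le[symmetric] by (intro decidable_not decidable_le)

lemma decidable_all:
  assumes "decidable (Suc k) (\<lambda>g ys. P g (ys ! 0) (drop 1 ys))" "recursive k A"
  shows "decidable k (\<lambda>g xs. \<forall>m<A g xs. P g m xs)"
proof (rule decidable_cong)
  show "decidable k (\<lambda>g xs. (\<Sum>m<A g xs. of_bool (\<not> P g m xs)) = (0::nat))"
    by (intro decidable_eq recursive_sum recursive_const assms recursive_of_bool decidable_not)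
qed auto

lemma decidable_ex:
  assumes "decidable (Suc k) (\<lambda>g ys. P g (ys ! 0) (drop 1 ys))" "recursive k A"
  shows "decidable k (\<lambda>g xs. \<exists>m<A g xs. P g m xs)"
  by (rule decidable_cong[of _ "\<lambda>g xs. \<not> (\<forall>m<A g xs. \<not> P g m xs)"])
    (intro decidable_not decidable_all assms, auto)

lemma recursive_If:
  assumes "decidable k P" "recursive k A" "recursive k B"
  shows "recursive k (\<lambda>g xs. if P g xs then A g xs else B g xs)"
  by (rule recursive_cong[of _ "\<lambda>g xs. of_bool (P g xs) * A g xs + of_bool (\<not> P g xs) * B g xs"])
    (intro recursive_add recursive_mult recursive_of_bool decidable_not assms, auto)

lemma recursive_div:
  assumes "recursive k A" "recursive k B"
  shows "recursive k (\<lambda>g xs. A g xs div B g xs)"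
proof (rule recursive_comp2[where F = "\<lambda>_. (div)", OF _ assms], rule recursive_cong)
  show "recursive 2 (\<lambda>g xs. \<Sum>m<xs ! 0. of_bool (0 < xs ! 1 \<and> Suc m * xs ! 1 \<le> xs ! 0))"
    by (intro recursive_sum recursive_of_bool decidable_conj decidable_less decidable_le recursive_mult recursive_Suc recursive_const recursive_nth
        recursive_nth_drop) auto
  have "(\<Sum>m<a. of_bool (0 < b \<and> Suc m * b \<le> a)) = a div b" for a b :: nat
  proof (cases "b = 0")
    case False
    have "{..<a} \<inter> {m. Suc m * b \<le> a} = {..<a div b}"
      using False by (auto simp: less_eq_div_iff_mult_less_eq Suc_le_eq[symmetric] simp del: mult_Suc)
        (metis Suc_le_lessD div_le_dividend le_trans less_eq_div_iff_mult_less_eq)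
    with False show ?thesis by (simp add: sum_of_bool_eq del: mult_Suc)
  qed auto
  then show "(\<Sum>m<xs ! 0. of_bool (0 < xs ! 1 \<and> Suc m * xs ! 1 \<le> xs ! 0)) = xs ! 0 div xs ! 1"
    for xs :: "nat list" by blast
qed

lemma Least_eq_sum:
  fixes P :: "nat \<Rightarrow> bool"
  assumes "n < s" "P n"
  shows "(LEAST n. P n) = (\<Sum>n<s. of_bool (\<forall>m<Suc n. \<not> P m))"
proof -
  have l: "P (LEAST n. P n)" "(LEAST n. P n) < s"
    using LeastI[of P, OF assms(2)] Least_le[of P, OF assms(2)] assms(1) by auto
  have "{..<s} \<inter> {n. \<forall>m<Suc n. \<not> P m} = {..<LEAST n. P n}"
  proof (intro set_eqI iffI)
    fix x assume "x \<in> {..<s} \<inter> {n. \<forall>m<Suc n. \<not> P m}"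
    then show "x \<in> {..<LEAST n. P n}" using l by (auto simp: not_le[symmetric])
  next
    fix x assume "x \<in> {..<LEAST n. P n}"
    then show "x \<in> {..<s} \<inter> {n. \<forall>m<Suc n. \<not> P m}"
      using l(2) by (auto dest: Least_le[of P])
  qed
  then show ?thesis by (simp add: sum_of_bool_eq)
qed

lemmas recursive_intros = recursive_const recursive_nth recursive_nth_drop recursive_nth_drop2
  recursive_nth_drop3 recursive_Suc recursive_oracle recursive_add recursive_mult
  recursive_power recursive_diff recursive_div recursive_sum recursive_of_bool recursive_If decidable_le decidable_less decidable_eq decidable_conj
  decidable_disj decidable_imp decidable_not decidable_all decidable_ex

definition encode_option :: "nat option \<Rightarrow> nat" where
  "encode_option r = (case r of None \<Rightarrow> 0 | Some v \<Rightarrow> Suc v)"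

lemma encode_option_simps [simp]: "encode_option None = 0" "encode_option (Some v) = Suc v"
  by (auto simp: encode_option_def)

lemma encode_option_eq_0_iff [simp]: "encode_option r = 0 \<longleftrightarrow> r = None"
  by (cases r) auto

lemma encode_option_eq_Suc_iff [simp]: "encode_option r = Suc v \<longleftrightarrow> r = Some v"
  by (cases r) auto

lemma encode_option_pred: "r \<noteq> None \<Longrightarrow> encode_option r - 1 = the r"
  by (cases r) auto

lemma decidable_ball_list:
  assumes "\<forall>q\<in>set qs. decidable k (P q)"
  shows "decidable k (\<lambda>g xs. \<forall>q\<in>set qs. P q g xs)"
  using assms
proof (induction qs)
  case Nil
  have "decidable k (\<lambda>g xs. 0 \<le> (0::nat))" by (intro decidable_le recursive_const)
  then show ?case by simp
qed (auto intro: decidable_conj)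

lemma map_nth_upt_eq_drop: "length xs = n \<Longrightarrow> map ((!) xs) [m..<n] = drop m xs"
  by (intro nth_equalityI) auto

lemma recursive_list_arg:
  assumes E: "recursive (Suc k) (\<lambda>g zs. E g (zs ! 0) (drop 1 zs))" and A: "recursive (j + k) A"
  shows "recursive (j + k) (\<lambda>g zs. E g (A g zs) (drop j zs))"
proof (rule recursive_cong)
  show "recursive (j + k) (\<lambda>g zs. E g (A g zs) (map ((!) zs) [j..<j + k]))"
    using recursive_map[OF E, of "A # map (\<lambda>i g xs. xs ! i) [j..<j + k]" "j + k"] A
    by (simp add: recursive_nth comp_def)
qed (simp add: map_nth_upt_eq_drop)

text \<open>
  The argument list \<open>s # c # xs\<close> carries the bound \<open>s\<close> and a parameter \<open>c\<close> of the simulated oracle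
  \<open>h g c\<close>, such as the code of a finite set.  Since programs do not record arities, the simulating
  program depends on \<open>k\<close>.
\<close>

lemma recursive_eval_within:
  assumes h: "recursive 2 (\<lambda>g xs. h g (xs ! 0) (xs ! 1))"
  shows "recursive (Suc (Suc k)) (\<lambda>g ys. encode_option (eval_within p (h g (ys ! 1)) (ys ! 0) (drop 2 ys)))"
proof (induction p arbitrary: k)
  case Zero
  show ?case by (simp add: recursive_const)
next
  case Succ
  show ?case
  proof (cases k)
    case 0
    show ?thesis by (rule recursive_cong[OF recursive_const[of _ 0]]) (simp add: 0)
  next
    case (Suc k')
    have "recursive (Suc (Suc k)) (\<lambda>g ys. Suc (Suc (ys ! 2)))"
      by (intro recursive_intros) (simp add: Suc)
    then show ?thesis
      by (rule recursive_cong) (auto simp: Suc length_Suc_conv numeral_2_eq_2)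
  qed
next
  case (Proj i)
  show ?case
  proof (cases "i < k")
    case False
    then show ?thesis by (intro recursive_cong[OF recursive_const[of _ 0]]) simp
  next
    case True
    have "recursive (Suc (Suc k)) (\<lambda>g ys. Suc (ys ! (2 + i)))"
      by (intro recursive_intros) (simp add: True)
    then show ?thesis
      by (rule recursive_cong) (simp add: True)
  qed
next
  case Oracle
  show ?case
  proof (cases k)
    case 0
    show ?thesis by (rule recursive_cong[OF recursive_const[of _ 0]]) (simp add: 0)
  next
    case (Suc k')
    have "recursive (Suc (Suc k)) (\<lambda>g ys. if ys ! 2 < ys ! 0 then Suc (h g (ys ! 1) (ys ! 2)) else 0)"
      by (intro recursive_intros recursive_comp2[OF h]) (simp_all add: Suc)
    then show ?thesis
      by (rule recursive_cong) (auto simp: Suc length_Suc_conv numeral_2_eq_2)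
  qed
next
  case (Comp p qs)
  let ?E = "\<lambda>q g ys. eval_within q (h g (ys ! 1)) (ys ! 0) (drop 2 ys)"
  have "recursive (Suc (Suc k)) (\<lambda>g ys. if \<forall>q\<in>set qs. encode_option (?E q g ys) \<noteq> 0 then
     encode_option (eval_within p (h g (ys ! 1)) (ys ! 0) (map (\<lambda>q. encode_option (?E q g ys) - 1) qs)) else 0)"
  proof (intro recursive_If recursive_const)
    show "decidable (Suc (Suc k)) (\<lambda>g ys. \<forall>q\<in>set qs. encode_option (?E q g ys) \<noteq> 0)"
      using Comp.IH(2) by (intro decidable_ball_list ballI decidable_not decidable_eq recursive_const)
    show "recursive (Suc (Suc k)) (\<lambda>g ys. encode_option (eval_within p (h g (ys ! 1)) (ys ! 0) (map (\<lambda>q. encode_option (?E q g ys) - 1) qs)))"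
      using recursive_map[OF Comp.IH(1)[of "length qs"], of "(\<lambda>g ys. ys ! 0) # (\<lambda>g ys. ys ! 1) #
          map (\<lambda>q g ys. encode_option (?E q g ys) - 1) qs" "Suc (Suc k)"] Comp.IH(2)
      by (simp add: recursive_nth recursive_pred[simplified] comp_def)
  qed
  then show ?case
  proof (rule recursive_cong)
    fix g and ys :: "nat list"
    show "(if \<forall>q\<in>set qs. encode_option (?E q g ys) \<noteq> 0 then
     encode_option (eval_within p (h g (ys ! 1)) (ys ! 0) (map (\<lambda>q. encode_option (?E q g ys) - 1) qs)) else 0) =
      encode_option (eval_within (Comp p qs) (h g (ys ! 1)) (ys ! 0) (drop 2 ys))"
    proof (cases "\<forall>q\<in>set qs. ?E q g ys \<noteq> None")
      case True
      then have "those (map (\<lambda>q. ?E q g ys) qs) = Some (map (\<lambda>q. encode_option (?E q g ys) - 1) qs)"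
        unfolding those_map_eq_Some_iff by (auto simp: encode_option_pred[simplified])
      with True show ?thesis by auto
    next
      case False
      then have "those (map (\<lambda>q. ?E q g ys) qs) = None"
      proof (cases "those (map (\<lambda>q. ?E q g ys) qs)")
        case (Some vs)
        with False have False unfolding those_map_eq_Some_iff
          by (metis in_set_conv_nth option.distinct(1))
        then show ?thesis ..
      qed
      with False show ?thesis by auto
    qed
  qed
next
  case (PrimRec p q)
  show ?case
  proof (cases k)
    case 0
    show ?thesis by (rule recursive_cong[OF recursive_const[of _ 0]]) (simp add: 0)
  next
    case (Suc j)
    define B where "B g ys = encode_option (eval_within p (h g (ys ! 1)) (ys ! 0) (drop 3 ys))" for g ys
    define S where "S g m r ys = (if r = 0 then 0 else
      encode_option (eval_within q (h g (ys ! 1)) (ys ! 0) (m # (r - 1) # drop 3 ys)))" for g m r ys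
    have B: "recursive (Suc (Suc k)) B"
    proof (rule recursive_cong)
      show "recursive (Suc (Suc k)) (\<lambda>g ys. encode_option (eval_within p (h g (ys ! 1)) (ys ! 0) (map ((!) ys) [3..<Suc (Suc k)])))"
        using recursive_map[OF PrimRec.IH(1)[of j], of "map (\<lambda>i g ys. ys ! i) ([0, 1] @ [3..<Suc (Suc k)])" "Suc (Suc k)"]
        by (simp add: recursive_nth comp_def Suc del: upt_Suc)
    qed (simp add: B_def map_nth_upt_eq_drop del: upt_Suc)
    have S: "recursive (Suc (Suc (Suc (Suc k)))) (\<lambda>g ys. S g (ys ! 0) (ys ! 1) (drop 2 ys))"
    proof (rule recursive_cong)
      let ?k = "Suc (Suc (Suc (Suc k)))"
      show "recursive ?k (\<lambda>g ys. if ys ! 1 = 0 then 0 else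
         encode_option (eval_within q (h g (ys ! 3)) (ys ! 2) (ys ! 0 # (ys ! 1 - 1) # map ((!) ys) [5..<?k])))"
      proof (intro recursive_If decidable_eq recursive_const recursive_nth)
        show "recursive ?k (\<lambda>g ys. encode_option (eval_within q (h g (ys ! 3)) (ys ! 2) (ys ! 0 # (ys ! 1 - 1) # map ((!) ys) [5..<?k])))"
          using recursive_map[OF PrimRec.IH(2)[of "Suc (Suc j)"], of
            "[\<lambda>g ys. ys ! 2, \<lambda>g ys. ys ! 3, \<lambda>g ys. ys ! 0, \<lambda>g ys. ys ! 1 - 1] @
              map (\<lambda>i g ys. ys ! i) [5..<?k]" ?k]
          by (simp add: recursive_nth recursive_pred[simplified] comp_def Suc numeral_eq_Suc del: upt_Suc)
      qed simp
    qed (simp add: S_def map_nth_upt_eq_drop numeral_eq_Suc del: upt_Suc)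
    have "recursive (Suc (Suc k)) (\<lambda>g ys. rec_nat (B g ys) (\<lambda>m r. S g m r ys) (ys ! 2))"
      using B S by (intro recursive_primrec recursive_nth) (auto simp: Suc)
    then show ?thesis
    proof (rule recursive_cong)
      fix g and ys :: "nat list" assume "length ys = Suc (Suc k)"
      then obtain s c n zs where ys: "ys = s # c # n # zs" by (auto simp: Suc length_Suc_conv)
      have "rec_nat (B g ys) (\<lambda>m r. S g m r ys) n =
        encode_option (rec_nat (eval_within p (h g c) s zs) (\<lambda>m r. Option.bind r (\<lambda>y. eval_within q (h g c) s (m # y # zs))) n)" for n
      proof (induction n)
        case 0
        then show ?case by (simp add: B_def ys)
      next
        case (Suc n)
        show ?case
          by (cases "rec_nat (eval_within p (h g c) s zs) (\<lambda>m r. Option.bind r (\<lambda>y. eval_within q (h g c) s (m # y # zs))) n")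
            (use Suc in \<open>simp_all add: S_def ys\<close>)
      qed
      then show "rec_nat (B g ys) (\<lambda>m r. S g m r ys) (ys ! 2) =
         encode_option (eval_within (PrimRec p q) (h g (ys ! 1)) (ys ! 0) (drop 2 ys))"
        by (simp add: ys)
    qed
  qed
next
  case (Mu p)
  define E where "E g n ys = encode_option (eval_within p (h g (ys ! 1)) (ys ! 0) (n # drop 2 ys))" for g n ys
  let ?k = "Suc (Suc k)"
  have E: "recursive (Suc ?k) (\<lambda>g zs. E g (zs ! 0) (drop 1 zs))"
  proof (rule recursive_cong)
    show "recursive (Suc ?k) (\<lambda>g ys. encode_option (eval_within p (h g (ys ! 2)) (ys ! 1) (ys ! 0 # map ((!) ys) [3..<Suc ?k])))"
      using recursive_map[OF Mu.IH[of "Suc k"], of "map (\<lambda>i g ys. ys ! i) ([1, 2, 0] @ [3..<Suc ?k])" "Suc ?k"]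
      by (simp add: recursive_nth comp_def numeral_eq_Suc del: upt_Suc)
  qed (simp add: E_def map_nth_upt_eq_drop numeral_eq_Suc del: upt_Suc)
  have E1: "recursive (Suc ?k) A \<Longrightarrow> recursive (Suc ?k) (\<lambda>g zs. E g (A g zs) (drop 1 zs))" for A
    using recursive_list_arg[OF E, of 1 A] by simp
  have E2: "recursive (Suc (Suc ?k)) A \<Longrightarrow> recursive (Suc (Suc ?k)) (\<lambda>g zs. E g (A g zs) (drop 1 (drop 1 zs)))" for A
    using recursive_list_arg[OF E, of 2 A] by (simp add: numeral_eq_Suc)
  have "recursive ?k (\<lambda>g ys. if \<exists>n<ys ! 0. E g n ys = 1 \<and> (\<forall>m<n. E g m ys \<noteq> 0) then
     Suc (\<Sum>n<ys ! 0. of_bool (\<forall>m<Suc n. \<not> E g m ys = 1)) else 0)"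
    by (intro recursive_intros E1 E2) auto
  then show ?case
  proof (rule recursive_cong)
    fix g and ys :: "nat list"
    show "(if \<exists>n<ys ! 0. E g n ys = 1 \<and> (\<forall>m<n. E g m ys \<noteq> 0) then
     Suc (\<Sum>n<ys ! 0. of_bool (\<forall>m<Suc n. \<not> E g m ys = 1)) else 0) =
      encode_option (eval_within (Mu p) (h g (ys ! 1)) (ys ! 0) (drop 2 ys))"
    proof (cases "\<exists>n<ys ! 0. E g n ys = 1 \<and> (\<forall>m<n. E g m ys \<noteq> 0)")
      case True
      then obtain n where "n < ys ! 0" "E g n ys = 1" by blast
      with Least_eq_sum[of n "ys ! 0" "\<lambda>n. E g n ys = 1"] True show ?thesis by (simp add: E_def)
    next
      case False
      then have "\<not> (\<exists>n<ys ! 0. eval_within p (h g (ys ! 1)) (ys ! 0) (n # drop 2 ys) = Some 0 \<and>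
          (\<forall>m<n. eval_within p (h g (ys ! 1)) (ys ! 0) (m # drop 2 ys) \<noteq> None))"
        by (simp add: E_def)
      with False show ?thesis by (simp only: eval_within.simps if_False encode_option_simps)
    qed
  qed
qed

lemma recursive_ev1:
  assumes "recursive 2 (\<lambda>g xs. h g (xs ! 0) (xs ! 1))" "recursive k C" "recursive k S" "recursive k A"
  shows "recursive k (\<lambda>g xs. encode_option (eval_within p (h g (C g xs)) (S g xs) [A g xs]))"
  using recursive_map[OF recursive_eval_within[OF assms(1), of 1], of "[S, C, A]" k] assms(2-4) by simp

lemma decidable_eval_within_eq_Some:
  assumes "recursive 2 (\<lambda>g xs. h g (xs ! 0) (xs ! 1))" "recursive k C" "recursive k S" "recursive k A" "recursive k V"
  shows "decidable k (\<lambda>g xs. eval_within p (h g (C g xs)) (S g xs) [A g xs] = Some (V g xs))"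
  unfolding encode_option_eq_Suc_iff[symmetric] by (intro decidable_eq recursive_Suc assms recursive_ev1[of h])

lemma decidable_eval_within_eq_None:
  assumes "recursive 2 (\<lambda>g xs. h g (xs ! 0) (xs ! 1))" "recursive k C" "recursive k S" "recursive k A"
  shows "decidable k (\<lambda>g xs. eval_within p (h g (C g xs)) (S g xs) [A g xs] = None)"
  unfolding encode_option_eq_0_iff[symmetric] by (intro decidable_eq recursive_const assms recursive_ev1[of h])

lemma decidable_comp3:
  assumes "decidable 3 (\<lambda>g xs. R g (xs ! 0) (xs ! 1) (xs ! 2))" "recursive k A" "recursive k B" "recursive k C"
  shows "decidable k (\<lambda>g xs. R g (A g xs) (B g xs) (C g xs))"
  using recursive_map[OF assms(1)[unfolded decidable_def], of "[A, B, C]" k] assms(2-4)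
  by (simp add: decidable_def numeral_2_eq_2)

lemma trec2_program:
  assumes "recursive 2 (\<lambda>g xs. F g (xs ! 0) (xs ! 1))"
  shows "\<exists>t. \<forall>g a b. eval t g [a, b] = Some (F g a b)"
proof -
  obtain t where t: "\<And>g xs. length xs = 2 \<Longrightarrow> eval t g xs = Some (F g (xs ! 0) (xs ! 1))"
    using assms unfolding recursive_def by blast
  show ?thesis using t[of "[_, _]"] by (intro exI[of _ t]) simp
qed

lemma selection:
  assumes R: "decidable 3 (\<lambda>g xs. R g (xs ! 0) (xs ! 1) (xs ! 2))"
  shows "\<exists>t. \<forall>g n. (\<forall>v. eval t g [n] = Some v \<longrightarrow> (\<exists>s. R g n v s)) \<and>
                   ((\<exists>v s. R g n v s) \<longrightarrow> eval t g [n] \<noteq> None)"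
proof -
  define Q where "Q g w n \<longleftrightarrow> (\<exists>v<w. \<exists>s<w. R g n v s)" for g w n
  define L where "L g w n = (\<Sum>v<w. of_bool (\<forall>u<Suc v. \<not> (\<exists>s<w. R g n u s)) :: nat)" for g w n
  have "recursive 2 (\<lambda>g xs. of_bool (\<not> Q g (xs ! 0) (xs ! 1)))"
    unfolding Q_def by (intro recursive_intros decidable_comp3[OF R]) auto
  then obtain q where q: "\<And>g w n. eval q g [w, n] = Some (of_bool (\<not> Q g w n))"
    using trec2_program[of "\<lambda>g w n. of_bool (\<not> Q g w n)"] by blast
  have "recursive 2 (\<lambda>g xs. L g (xs ! 0) (xs ! 1))"
    unfolding L_def by (intro recursive_intros decidable_comp3[OF R]) auto
  then obtain l where l: "\<And>g w n. eval l g [w, n] = Some (L g w n)"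
    using trec2_program[of L] by blast
  have *: "eval (Comp l [Mu q, Proj 0]) g [n] =
      (if \<exists>w. Q g w n then Some (L g (LEAST w. Q g w n) n) else None)" for g n
    by (auto simp: q l)
  have LR: "\<exists>s. R g n (L g w n) s" if Q: "Q g w n" for g w n
  proof -
    obtain v where v: "v < w" "\<exists>s<w. R g n v s" using Q unfolding Q_def by blast
    have "L g w n = (LEAST v. \<exists>s<w. R g n v s)" unfolding L_def
      using Least_eq_sum[of v w "\<lambda>v. \<exists>s<w. R g n v s"] v by simp
    then show ?thesis using LeastI[of "\<lambda>v. \<exists>s<w. R g n v s", OF v(2)] by auto
  qed
  have QR: "\<exists>w. Q g w n" if "R g n v s" for g n v s
    using that unfolding Q_def
    by (intro exI[of _ "Suc (max v s)"] exI[of _ v] exI[of _ s] conjI) auto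
  show ?thesis
  proof (intro exI[of _ "Comp l [Mu q, Proj 0]"] allI conjI impI)
    fix g n v assume "eval (Comp l [Mu q, Proj 0]) g [n] = Some v"
    then have "\<exists>w. Q g w n" "v = L g (LEAST w. Q g w n) n" unfolding * by (auto split: if_splits)
    with LR[OF LeastI_ex[of "\<lambda>w. Q g w n"]] show "\<exists>s. R g n v s" by simp
  next
    fix g n assume "\<exists>v s. R g n v s"
    with QR have "\<exists>w. Q g w n" by blast
    then show "eval (Comp l [Mu q, Proj 0]) g [n] \<noteq> None" unfolding * by simp
  qed
qed


section \<open>Cylinders in the coin-tossing space\<close>

definition coin :: "(nat \<Rightarrow> bool) measure" where
  "coin = (\<Pi>\<^sub>M i\<in>UNIV. measure_pmf (bernoulli_pmf (1 / 2)))"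

definition depends_below :: "nat \<Rightarrow> (nat \<Rightarrow> bool) set \<Rightarrow> bool" where
  "depends_below N K \<longleftrightarrow> (\<forall>x y. (\<forall>i<N. x i = y i) \<longrightarrow> (x \<in> K \<longleftrightarrow> y \<in> K))"

definition cylinder :: "nat \<Rightarrow> nat set \<Rightarrow> (nat \<Rightarrow> bool) set" where
  "cylinder N F = {x. \<forall>i<N. x i \<longleftrightarrow> i \<in> F}"

interpretation coin: prob_space coin
  unfolding coin_def by (intro prob_space_PiM prob_space_measure_pmf)

lemma space_coin [simp]: "space coin = UNIV"
  by (auto simp: coin_def space_PiM)

lemma coin_coordinate_sets: "{x. x i \<in> A} \<in> sets coin"
  using measurable_sets[OF measurable_component_singleton[of i UNIV "\<lambda>_. measure_pmf (bernoulli_pmf (1 / 2))"], of A]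
  by (simp add: coin_def[symmetric] vimage_def)

lemma cylinder_eq: "cylinder N F = {x \<in> space coin. \<forall>i\<in>{..<N}. x i \<in> {i \<in> F}}"
  by (auto simp: cylinder_def)

lemma sets_cylinder [simp]: "cylinder N F \<in> sets coin"
proof -
  have "cylinder N F = (\<Inter>i\<in>{..<N}. {x. x i = (i \<in> F)}) \<inter> space coin"
    by (auto simp: cylinder_def)
  also have "\<dots> \<in> sets coin"
    by (cases "N = 0") (auto simp: sets.top[of coin, simplified] intro!: sets.finite_INT coin_coordinate_sets[where A = "{_}", simplified])
  finally show ?thesis .
qed

lemma measure_cylinder: "measure coin (cylinder N F) = (1 / 2) ^ N"
proof -
  interpret product_prob_space "\<lambda>_. measure_pmf (bernoulli_pmf (1 / 2))" UNIV
    by unfold_locales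
  have "emeasure coin (cylinder N F) = (\<Prod>i\<in>{..<N}. emeasure (measure_pmf (bernoulli_pmf (1 / 2))) {i \<in> F})"
    unfolding cylinder_eq unfolding coin_def by (rule emeasure_PiM_Collect) auto
  also have "\<dots> = (\<Prod>i\<in>{..<N}. ennreal (1 / 2))"
  proof (rule prod.cong)
    fix i
    show "emeasure (measure_pmf (bernoulli_pmf (1 / 2))) {i \<in> F} = ennreal (1 / 2)"
      by (cases "i \<in> F") (simp_all add: emeasure_pmf_single)
  qed simp
  also have "\<dots> = ennreal ((1 / 2) ^ N)"
    by (subst prod_ennreal) simp_all
  finally show ?thesis by (simp add: measure_def)
qed

lemma depends_below_eq_Union_cylinder:
  assumes "depends_below N K"
  shows "K = (\<Union>F\<in>{F \<in> Pow {..<N}. (\<lambda>i. i \<in> F) \<in> K}. cylinder N F)"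
proof (intro set_eqI iffI)
  fix x assume x: "x \<in> K"
  have "(\<lambda>i. i \<in> {i. i < N \<and> x i}) \<in> K"
    using assms x unfolding depends_below_def by (metis (no_types, lifting) mem_Collect_eq)
  moreover have "x \<in> cylinder N {i. i < N \<and> x i}" by (auto simp: cylinder_def)
  ultimately show "x \<in> (\<Union>F\<in>{F \<in> Pow {..<N}. (\<lambda>i. i \<in> F) \<in> K}. cylinder N F)"
    by (intro UN_I[of "{i. i < N \<and> x i}"]) auto
next
  fix x assume "x \<in> (\<Union>F\<in>{F \<in> Pow {..<N}. (\<lambda>i. i \<in> F) \<in> K}. cylinder N F)"
  then obtain F where "(\<lambda>i. i \<in> F) \<in> K" "x \<in> cylinder N F" by blast
  then show "x \<in> K"
    using assms[unfolded depends_below_def, rule_format, of x "\<lambda>i. i \<in> F"] by (simp add: cylinder_def)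
qed

lemma depends_below_sets:
  assumes "depends_below N K"
  shows "K \<in> sets coin"
  by (subst depends_below_eq_Union_cylinder[OF assms]) (rule sets.finite_UN, simp_all)

lemma disjoint_cylinder: "disjoint_family_on (cylinder N) (Pow {..<N})"
  unfolding disjoint_family_on_def
proof (intro ballI impI)
  fix F G assume FG: "F \<in> Pow {..<N}" "G \<in> Pow {..<N}" "F \<noteq> G"
  then obtain i where "i < N" "i \<in> F \<longleftrightarrow> i \<notin> G" by auto
  then show "cylinder N F \<inter> cylinder N G = {}" by (auto simp: cylinder_def)
qed

lemma measure_depends_below_Int:
  assumes K: "depends_below N K" and C: "C \<in> sets coin"
  shows "measure coin (C \<inter> K) = (\<Sum>F\<in>{F \<in> Pow {..<N}. (\<lambda>i. i \<in> F) \<in> K}. measure coin (C \<inter> cylinder N F))"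
proof -
  let ?S = "{F \<in> Pow {..<N}. (\<lambda>i. i \<in> F) \<in> K}"
  have eq: "measure coin (C \<inter> K) = measure coin (\<Union>F\<in>?S. C \<inter> cylinder N F)"
    by (subst depends_below_eq_Union_cylinder[OF K]) (simp only: Int_UN_distrib)
  have "disjoint_family_on (\<lambda>F. C \<inter> cylinder N F) ?S"
    using disjoint_cylinder[of N] unfolding disjoint_family_on_def by blast
  then have "measure coin (\<Union>F\<in>?S. C \<inter> cylinder N F) = (\<Sum>F\<in>?S. measure coin (C \<inter> cylinder N F))"
    using C by (intro coin.finite_measure_finite_Union) auto
  with eq show ?thesis by simp
qed

lemma measure_depends_below:
  assumes K: "depends_below N K"
  shows "measure coin K = card {F \<in> Pow {..<N}. (\<lambda>i. i \<in> F) \<in> K} * (1 / 2) ^ N"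
  using measure_depends_below_Int[OF K sets.top] by (simp add: measure_cylinder)

lemma depends_below_mono: "depends_below N K \<Longrightarrow> N \<le> M \<Longrightarrow> depends_below M K"
  unfolding depends_below_def using order_less_le_trans by blast

lemma coin_approx:
  assumes "A \<in> sets coin" "\<epsilon> > 0"
  shows "\<exists>N K. depends_below N K \<and> measure coin (A - K) < \<epsilon> \<and> measure coin (K - A) < \<epsilon>"
proof -
  have "A \<in> sigma_sets (\<Pi>\<^sub>E i\<in>UNIV. space (measure_pmf (bernoulli_pmf (1 / 2))))
      {{f \<in> \<Pi>\<^sub>E i\<in>UNIV. space (measure_pmf (bernoulli_pmf (1 / 2))). f i \<in> B} |i B.
        i \<in> (UNIV :: nat set) \<and> B \<in> sets (measure_pmf (bernoulli_pmf (1 / 2)))}"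
    using assms(1) unfolding coin_def sets_PiM_single .
  then have "A \<in> sigma_sets UNIV {{f. f i \<in> B} |i B. True}"
    by simp
  then show ?thesis using assms(2)
  proof (induction arbitrary: \<epsilon>)
    case (Basic a)
    then obtain i B where "a = {f. f i \<in> B}" by blast
    then have "depends_below (Suc i) a" by (auto simp: depends_below_def)
    with Basic show ?case by (intro exI[of _ "Suc i"] exI[of _ a]) simp
  next
    case Empty
    then show ?case by (intro exI[of _ 0] exI[of _ "{}"]) (simp add: depends_below_def)
  next
    case (Compl a)
    then obtain N K where NK: "depends_below N K" "measure coin (a - K) < \<epsilon>" "measure coin (K - a) < \<epsilon>" by blast
    have eq: "UNIV - a - (UNIV - K) = K - a" "UNIV - K - (UNIV - a) = a - K" by blast+
    have "depends_below N (UNIV - K)" using NK(1) by (auto simp: depends_below_def)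
    with NK show ?case by (intro exI[of _ N] exI[of _ "UNIV - K"]) (simp add: eq)
  next
    case (Union a)
    have a: "a i \<in> sets coin" for i
    proof -
      have "sigma_sets UNIV {{f. f i \<in> B} |(i::nat) (B::bool set). True} \<subseteq> sets coin"
        by (rule sets.sigma_sets_subset[of _ coin, simplified]) (auto intro: coin_coordinate_sets)
      then show ?thesis using Union.hyps by blast
    qed
    have "(\<lambda>n. measure coin (\<Union>i<n. a i)) \<longlonglongrightarrow> measure coin (\<Union>n. \<Union>i<n. a i)"
      by (rule coin.finite_Lim_measure_incseq) (use a in \<open>auto simp: incseq_def intro: less_le_trans\<close>)
    also have "(\<Union>n. \<Union>i<n. a i) = (\<Union>i. a i)" using lessI by blast
    finally have "eventually (\<lambda>n. measure coin (\<Union>i<n. a i) > measure coin (\<Union>i. a i) - \<epsilon> / 2) sequentially"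
      using Union.prems by (intro order_tendstoD) auto
    then obtain n where n: "measure coin (\<Union>i. a i) - \<epsilon> / 2 < measure coin (\<Union>i<n. a i)"
      by (auto simp: eventually_sequentially)
    define \<delta> where "\<delta> = \<epsilon> / (2 * real (Suc n))"
    have \<delta>: "\<delta> > 0" "real n * \<delta> < \<epsilon> / 2"
      using Union.prems by (auto simp: \<delta>_def field_simps)
    obtain N K where NK: "\<And>i. depends_below (N i) (K i)" "\<And>i. measure coin (a i - K i) < \<delta>" "\<And>i. measure coin (K i - a i) < \<delta>"
      using Union.IH[OF \<delta>(1)] by metis
    have K: "K i \<in> sets coin" for i using NK(1) depends_below_sets by blast
    have depends_below: "depends_below (\<Sum>i<n. N i) (\<Union>i<n. K i)"
    proof -
      have "depends_below (\<Sum>i<n. N i) (K i)" if "i < n" for i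
        using NK(1) by (rule depends_below_mono) (use that in \<open>auto intro: member_le_sum\<close>)
      then show ?thesis unfolding depends_below_def by (metis (no_types, lifting) UN_iff lessThan_iff)
    qed
    have 1: "measure coin ((\<Union>i<n. K i) - (\<Union>i. a i)) < \<epsilon>"
    proof -
      have "measure coin ((\<Union>i<n. K i) - (\<Union>i. a i)) \<le> measure coin (\<Union>i<n. K i - a i)"
        by (intro coin.finite_measure_mono) (use a K in auto)
      also have "\<dots> \<le> (\<Sum>i<n. measure coin (K i - a i))"
        by (intro coin.finite_measure_subadditive_finite) (use a K in auto)
      also have "\<dots> \<le> (\<Sum>i<n. \<delta>)" by (intro sum_mono less_imp_le NK)
      also have "\<dots> < \<epsilon>" using \<delta>(2) Union.prems by simp
      finally show ?thesis .
    qed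
    have 2: "measure coin ((\<Union>i. a i) - (\<Union>i<n. K i)) < \<epsilon>"
    proof -
      have "measure coin ((\<Union>i. a i) - (\<Union>i<n. K i)) \<le>
          measure coin (((\<Union>i. a i) - (\<Union>i<n. a i)) \<union> (\<Union>i<n. a i - K i))"
        by (intro coin.finite_measure_mono) (use a K in auto)
      also have "\<dots> \<le> measure coin ((\<Union>i. a i) - (\<Union>i<n. a i)) + measure coin (\<Union>i<n. a i - K i)"
        by (intro measure_Un_le) (use a K in auto)
      also have "measure coin ((\<Union>i. a i) - (\<Union>i<n. a i)) = measure coin (\<Union>i. a i) - measure coin (\<Union>i<n. a i)"
        by (intro coin.finite_measure_Diff) (use a in auto)
      also have "measure coin (\<Union>i<n. a i - K i) \<le> (\<Sum>i<n. measure coin (a i - K i))"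
        by (intro coin.finite_measure_subadditive_finite) (use a K in auto)
      also have "\<dots> \<le> (\<Sum>i<n. \<delta>)" by (intro sum_mono less_imp_le NK)
      finally show ?thesis using \<delta>(2) n by simp
    qed
    from depends_below 1 2 show ?case by blast
  qed
qed

lemma majority_cylinder:
  assumes C: "C \<in> sets coin" and pos: "measure coin C > 0"
  shows "\<exists>N. \<exists>F\<subseteq>{..<N}. measure coin (C \<inter> cylinder N F) > (1 / 2) ^ N / 2"
proof (rule ccontr)
  assume "\<not> ?thesis"
  then have le: "measure coin (C \<inter> cylinder N F) \<le> (1 / 2) ^ N / 2" if "F \<subseteq> {..<N}" for N F
    using that by (auto simp: not_less)
  obtain N K where K: "depends_below N K" "measure coin (C - K) < measure coin C / 2" "measure coin (K - C) < measure coin C / 2"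
    using coin_approx[OF C, of "measure coin C / 2"] pos by auto
  have Ks: "K \<in> sets coin" using K(1) by (rule depends_below_sets)
  let ?S = "{F \<in> Pow {..<N}. (\<lambda>i. i \<in> F) \<in> K}"
  have "measure coin (C \<inter> K) = (\<Sum>F\<in>?S. measure coin (C \<inter> cylinder N F))"
    by (rule measure_depends_below_Int[OF K(1) C])
  also have "\<dots> \<le> (\<Sum>F\<in>?S. (1 / 2) ^ N / 2)" by (intro sum_mono le) auto
  also have "\<dots> = measure coin K / 2" by (simp add: measure_depends_below[OF K(1)])
  also have "measure coin K = measure coin (C \<inter> K) + measure coin (K - C)"
    using coin.finite_measure_Diff'[OF Ks C] by (simp add: Int_commute)
  finally have "measure coin (C \<inter> K) \<le> measure coin (K - C)" by simp
  moreover have "measure coin C = measure coin (C \<inter> K) + measure coin (C - K)"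
    using coin.finite_measure_Diff'[OF C Ks] by simp
  ultimately show False using K(2,3) by simp
qed

lemma null_sets_cantor_measureI:
  assumes "{x. Collect x \<in> C} \<in> null_sets coin"
  shows "C \<in> null_sets cantor_measure"
proof -
  let ?A = "{x. Collect x \<in> C}"
  have C: "C = Collect ` ?A"
  proof (intro equalityI subsetI)
    fix X assume "X \<in> C"
    then show "X \<in> Collect ` ?A" by (intro image_eqI[of _ _ "\<lambda>i. i \<in> X"]) auto
  qed auto
  have inj: "inj (Collect :: (nat \<Rightarrow> bool) \<Rightarrow> nat set)" by (auto simp: inj_def)
  have s: "Collect ` ?A \<in> sets (embed_measure coin Collect)"
    using assms by (intro in_sets_embed_measure) auto
  have "emeasure (embed_measure coin Collect) (Collect ` ?A) = emeasure coin ?A"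
    using emeasure_embed_measure[OF inj s] inj by (simp add: inj_vimage_image_eq)
  then have "Collect ` ?A \<in> null_sets (embed_measure coin Collect)"
    using assms s by (auto simp: null_sets_def)
  then show ?thesis
    unfolding cantor_measure_def coin_def[symmetric] C[symmetric] by (rule null_sets_completionI)
qed


section \<open>Density and majority vote\<close>

lemma has_density_1_mono:
  assumes "has_density A 1" "A \<subseteq> B"
  shows "has_density B 1"
  unfolding has_density_def
proof (rule tendsto_sandwich)
  show "(\<lambda>n. real (card (A \<inter> {0..<n})) / real n) \<longlonglongrightarrow> 1"
    using assms(1) by (simp add: has_density_def)
  show "\<forall>\<^sub>F n in sequentially. real (card (A \<inter> {0..<n})) / real n \<le> real (card (B \<inter> {0..<n})) / real n"
    using assms(2) by (intro always_eventually allI divide_right_mono of_nat_mono card_mono) auto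
  have "card (B \<inter> {0..<n}) \<le> n" for n
    using card_mono[of "{0..<n}" "B \<inter> {0..<n}"] by simp
  then show "\<forall>\<^sub>F n in sequentially. real (card (B \<inter> {0..<n})) / real n \<le> 1"
    by (intro always_eventually allI) (simp add: divide_le_eq)
qed (rule tendsto_const)

lemma has_density_1_iff:
  "has_density A 1 \<longleftrightarrow> (\<forall>k. \<exists>N. \<forall>n\<ge>N. k * n \<le> Suc k * card (A \<inter> {0..<n}))"
proof
  assume A: "has_density A 1"
  show "\<forall>k. \<exists>N. \<forall>n\<ge>N. k * n \<le> Suc k * card (A \<inter> {0..<n})"
  proof
    fix k
    have "\<forall>\<^sub>F n in sequentially. real k / real (Suc k) < real (card (A \<inter> {0..<n})) / real n"
      using A unfolding has_density_def by (rule order_tendstoD) simp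
    then obtain N where N: "\<And>n. n \<ge> N \<Longrightarrow> real k / real (Suc k) < real (card (A \<inter> {0..<n})) / real n"
      by (auto simp: eventually_sequentially)
    have "k * n \<le> Suc k * card (A \<inter> {0..<n})" if "n \<ge> N" for n
    proof (cases "n = 0")
      case False
      with N[OF that] have "real k * real n < real (card (A \<inter> {0..<n})) * real (Suc k)"
        by (simp add: divide_less_eq less_divide_eq)
      then have "real (k * n) < real (Suc k * card (A \<inter> {0..<n}))" by (simp add: algebra_simps)
      then show ?thesis unfolding of_nat_less_iff by simp
    qed simp
    then show "\<exists>N. \<forall>n\<ge>N. k * n \<le> Suc k * card (A \<inter> {0..<n})" by blast
  qed
next
  assume *: "\<forall>k. \<exists>N. \<forall>n\<ge>N. k * n \<le> Suc k * card (A \<inter> {0..<n})"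
  show "has_density A 1" unfolding has_density_def
  proof (rule LIMSEQ_I)
    fix r :: real assume "r > 0"
    then obtain k where k: "inverse (real (Suc k)) < r" using reals_Archimedean by blast
    obtain N where N: "\<And>n. n \<ge> N \<Longrightarrow> k * n \<le> Suc k * card (A \<inter> {0..<n})" using * by blast
    have "norm (real (card (A \<inter> {0..<n})) / real n - 1) < r" if "n \<ge> Suc N" for n
    proof -
      have n: "n > 0" "n \<ge> N" using that by auto
      have "card (A \<inter> {0..<n}) \<le> n" using card_mono[of "{0..<n}" "A \<inter> {0..<n}"] by simp
      then have le: "real (card (A \<inter> {0..<n})) / real n \<le> 1" using n by (simp add: divide_le_eq)
      have "real (k * n) \<le> real (Suc k * card (A \<inter> {0..<n}))" using N[OF n(2)] of_nat_mono by blast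
      then have "real k / real (Suc k) \<le> real (card (A \<inter> {0..<n})) / real n"
        using n by (simp add: divide_le_eq le_divide_eq mult.commute del: of_nat_Suc) (simp add: algebra_simps)
      moreover have "real k / real (Suc k) = 1 - inverse (real (Suc k))" by (simp add: field_simps)
      ultimately show ?thesis using k le by simp
    qed
    then show "\<exists>no. \<forall>n\<ge>no. norm (real (card (A \<inter> {0..<n})) / real n - 1) < r" by blast
  qed
qed

text \<open>
  By dominated convergence the averages of \<open>\<mu>(Q \<inter> D k)\<close> tend to \<open>\<mu>(Q)\<close>, while each index \<open>k\<close>
  outside the set costs the average at least \<open>\<mu>(Q) - c\<close>.
\<close>

lemma density_by_averaging:
  assumes Q: "Q \<in> sets coin" and D: "\<And>k. D k \<in> sets coin"
    and dens: "\<And>x. x \<in> Q \<Longrightarrow> has_density {k. x \<in> D k} 1"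
    and c: "c < measure coin Q"
  shows "has_density {k. c < measure coin (Q \<inter> D k)} 1"
proof -
  define q where "q = measure coin Q"
  define u where "u n x = (\<Sum>k<n. indicator (Q \<inter> D k) x) / real n" for n and x
  define G where "G = {k. c < measure coin (Q \<inter> D k)}"
  have QD: "Q \<inter> D k \<in> sets coin" for k using Q D by simp
  have card_eq: "(\<Sum>k<n. indicator (Q \<inter> D k) x :: real) = indicator Q x * real (card ({k. x \<in> D k} \<inter> {0..<n}))" for n x
  proof -
    have "(\<Sum>k<n. indicator (Q \<inter> D k) x :: real) = (\<Sum>k<n. indicator Q x * of_bool (x \<in> D k))"
      by (intro sum.cong) (auto simp: indicator_def)
    also have "\<dots> = indicator Q x * real (card ({k. x \<in> D k} \<inter> {0..<n}))"
      by (simp add: sum_distrib_left[symmetric] sum_of_bool_eq atLeast0LessThan Int_commute)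
    finally show ?thesis .
  qed
  have lim: "(\<lambda>n. \<integral>x. u n x \<partial>coin) \<longlonglongrightarrow> (\<integral>x. indicator Q x \<partial>coin)"
  proof (rule integral_dominated_convergence[where w = "\<lambda>_. 1"])
    show "AE x in coin. (\<lambda>n. u n x) \<longlonglongrightarrow> indicator Q x"
    proof (rule AE_I2)
      fix x
      show "(\<lambda>n. u n x) \<longlonglongrightarrow> indicator Q x"
        using dens[of x] by (cases "x \<in> Q") (simp_all add: u_def card_eq has_density_def)
    qed
    show "AE x in coin. norm (u n x) \<le> 1" for n
    proof (rule AE_I2)
      fix x
      have "(\<Sum>k<n. indicator (Q \<inter> D k) x) \<le> (\<Sum>k<n. 1 :: real)"
        by (intro sum_mono) (auto simp: indicator_def)
      then show "norm (u n x) \<le> 1"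
        by (cases "n = 0") (simp_all add: u_def divide_le_eq sum_nonneg)
    qed
    show "u n \<in> borel_measurable coin" for n
      unfolding u_def using QD by (intro borel_measurable_divide borel_measurable_sum borel_measurable_indicator) auto
  qed (use Q in auto)
  have "(\<integral>x. u n x \<partial>coin) = (\<Sum>k<n. measure coin (Q \<inter> D k)) / real n" for n
    unfolding u_def using QD by (simp add: Bochner_Integration.integral_sum coin.emeasure_eq_measure)
  with lim have lim2: "(\<lambda>n. (\<Sum>k<n. measure coin (Q \<inter> D k)) / real n) \<longlonglongrightarrow> q"
    using Q by (simp add: q_def)
  have bound: "(\<Sum>k<n. measure coin (Q \<inter> D k)) \<le> real n * c + (q - c) * card (G \<inter> {0..<n})" for n
  proof -
    have "(\<Sum>k<n. measure coin (Q \<inter> D k)) \<le> (\<Sum>k<n. c + (q - c) * of_bool (k \<in> G))"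
    proof (rule sum_mono)
      fix k
      have "measure coin (Q \<inter> D k) \<le> q"
        unfolding q_def by (rule coin.finite_measure_mono) (use Q in auto)
      then show "measure coin (Q \<inter> D k) \<le> c + (q - c) * of_bool (k \<in> G)"
        by (auto simp: G_def)
    qed
    also have "\<dots> = real n * c + (q - c) * card (G \<inter> {0..<n})"
      by (simp add: sum.distrib sum_distrib_left[symmetric] sum_of_bool_eq atLeast0LessThan Int_commute)
    finally show ?thesis .
  qed
  have qc: "q - c > 0" using c by (simp add: q_def)
  have "(\<lambda>n. ((\<Sum>k<n. measure coin (Q \<inter> D k)) / real n - c) / (q - c)) \<longlonglongrightarrow> (q - c) / (q - c)"
    by (intro tendsto_intros lim2) (use qc in auto)
  then have lim3: "(\<lambda>n. ((\<Sum>k<n. measure coin (Q \<inter> D k)) / real n - c) / (q - c)) \<longlonglongrightarrow> 1"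
    using qc by simp
  show ?thesis
    unfolding has_density_def G_def[symmetric]
  proof (rule tendsto_sandwich[OF _ _ lim3 tendsto_const])
    show "\<forall>\<^sub>F n in sequentially. ((\<Sum>k<n. measure coin (Q \<inter> D k)) / real n - c) / (q - c)
        \<le> real (card (G \<inter> {0..<n})) / real n"
    proof (rule eventually_sequentiallyI[of 1])
      fix n :: nat assume n: "1 \<le> n"
      have "(\<Sum>k<n. measure coin (Q \<inter> D k)) / real n - c \<le> (q - c) * card (G \<inter> {0..<n}) / real n"
        using divide_right_mono[OF bound[of n], of "real n"] n by (simp add: add_divide_distrib)
      then show "((\<Sum>k<n. measure coin (Q \<inter> D k)) / real n - c) / (q - c)
        \<le> real (card (G \<inter> {0..<n})) / real n"
        using qc n by (simp add: pos_divide_le_eq mult.commute)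
    qed
    have "card (G \<inter> {0..<n}) \<le> n" for n
      using card_mono[of "{0..<n}" "G \<inter> {0..<n}"] by simp
    then show "\<forall>\<^sub>F n in sequentially. real (card (G \<inter> {0..<n})) / real n \<le> 1"
      by (intro always_eventually allI) (simp add: divide_le_eq)
  qed
qed

lemma set_decode_less_power: "c < 2 ^ s \<Longrightarrow> set_decode c \<subseteq> {..<s}"
proof
  fix i assume c: "c < 2 ^ s" and i: "i \<in> set_decode c"
  show "i \<in> {..<s}"
  proof (rule ccontr)
    assume "i \<notin> {..<s}"
    then have "c < 2 ^ i" using order_less_le_trans[OF c power_increasing[of s i "2::nat"]] by simp
    with i show False by (simp add: set_decode_def)
  qed
qed

lemma set_encode_less_power: "G \<subseteq> {..<s} \<Longrightarrow> set_encode G < 2 ^ s"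
proof -
  assume G: "G \<subseteq> {..<s}"
  then have "set_encode G \<le> (\<Sum>i<s. 2 ^ i)" unfolding set_encode_def by (intro sum_mono2) auto
  also have "\<dots> < 2 ^ s" by (induction s) auto
  finally show ?thesis .
qed

lemma card_set_decode:
  "card {c. c < 2 ^ s \<and> P (set_decode c)} = card {G \<in> Pow {..<s}. P G}"
proof (rule bij_betw_same_card[of set_decode], rule bij_betw_byWitness[of _ set_encode])
  show "\<forall>G\<in>{G \<in> Pow {..<s}. P G}. set_decode (set_encode G) = G"
    by (auto intro!: set_encode_inverse intro: finite_subset)
  show "set_encode ` {G \<in> Pow {..<s}. P G} \<subseteq> {c. c < 2 ^ s \<and> P (set_decode c)}"
    by (auto intro: set_encode_less_power simp: set_encode_inverse finite_subset)
qed (use set_decode_less_power in auto)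

lemma recursive_set_decode:
  assumes "recursive k A" "recursive k B"
  shows "recursive k (\<lambda>g xs. char_fun (set_decode (A g xs)) (B g xs))"
proof (rule recursive_cong)
  show "recursive k (\<lambda>g xs. A g xs div 2 ^ B g xs - 2 * (A g xs div 2 ^ B g xs div 2))"
    by (intro recursive_intros assms)
  have "c - 2 * (c div 2) = of_bool (odd c)" for c :: nat
    by (cases "even c") (auto elim!: oddE)
  then show "A g xs div 2 ^ B g xs - 2 * (A g xs div 2 ^ B g xs div 2) = char_fun (set_decode (A g xs)) (B g xs)" for g xs
    by (simp add: indicator_def set_decode_def)
qed

lemma depends_below_eval_within: "depends_below s {x. P (\<lambda>xs. eval_within p (char_fun (Collect x)) s xs)}"
proof -
  have "eval_within p (char_fun (Collect x)) s = eval_within p (char_fun (Collect y)) s"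
    if "\<forall>i<s. x i = y i" for x y
    by (intro ext eval_within_use) (use that in \<open>simp add: indicator_def\<close>)
  then show ?thesis unfolding depends_below_def mem_Collect_eq by metis
qed

lemma depends_below_Int:
  assumes "depends_below N K" "depends_below N L"
  shows "depends_below N (K \<inter> L)"
  unfolding depends_below_def
proof (intro allI impI)
  fix x y :: "nat \<Rightarrow> bool" assume "\<forall>i<N. x i = y i"
  with assms[unfolded depends_below_def, THEN spec, THEN spec, of x y] show "x \<in> K \<inter> L \<longleftrightarrow> y \<in> K \<inter> L"
    by simp
qed

lemma majority_vote:
  assumes C: "C \<in> sets coin" "measure coin C > 0"
    and gd: "\<And>x. x \<in> C \<Longrightarrow> generic_description (\<lambda>n. eval p (char_fun (Collect x)) [n]) f"
  shows "generically_computable f"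
proof -
  obtain N F where F: "F \<subseteq> {..<N}" and maj: "measure coin (C \<inter> cylinder N F) > (1 / 2) ^ N / 2"
    using majority_cylinder[OF C] by blast
  have finF: "finite F" using F by (rule finite_subset) simp
  define E where "E n v s = cylinder N F \<inter> {x. eval_within p (char_fun (Collect x)) s [n] = Some v}" for n v s
  have depE: "depends_below s (E n v s)" if "N \<le> s" for n v s
    unfolding E_def
  proof (rule depends_below_Int)
    have "depends_below N (cylinder N F)" by (simp add: depends_below_def cylinder_def)
    then show "depends_below s (cylinder N F)" using that by (rule depends_below_mono)
  qed (rule depends_below_eval_within[of _ "\<lambda>e. e _ = _"])
  have E_sets: "E n v s \<in> sets coin" for n v s
    unfolding E_def using depends_below_sets[OF depends_below_eval_within[of _ "\<lambda>e. e _ = _"]] by (intro sets.Int) auto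
  define R where "R g n v s \<longleftrightarrow> N \<le> s \<and> (2::nat) ^ s < 2 * 2 ^ N * (\<Sum>c<2 ^ s. of_bool
     ((\<forall>i<N. char_fun (set_decode c) i = char_fun (set_decode (set_encode F)) i)
       \<and> eval_within p (char_fun (set_decode c)) s [n] = Some v))" for g :: "nat \<Rightarrow> nat" and n v s :: nat
  have decR: "decidable 3 (\<lambda>g xs. R g (xs ! 0) (xs ! 1) (xs ! 2))"
    unfolding R_def
    by (intro recursive_intros recursive_set_decode decidable_eval_within_eq_Some[of "\<lambda>g c. char_fun (set_decode c)"]) auto
  have R_iff: "R g n v s \<longleftrightarrow> N \<le> s \<and> measure coin (E n v s) > (1 / 2) ^ N / 2" for g n v s
  proof (cases "N \<le> s")
    case True
    have "(\<Sum>c<2 ^ s. of_bool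
     ((\<forall>i<N. char_fun (set_decode c) i = char_fun (set_decode (set_encode F)) i)
       \<and> eval_within p (char_fun (set_decode c)) s [n] = Some v)) =
       card {c. c < 2 ^ s \<and> (\<lambda>i. i \<in> set_decode c) \<in> E n v s}"
      unfolding sum_of_bool_eq[OF finite_lessThan]
      by (auto intro!: arg_cong[of _ _ card] simp: E_def cylinder_def set_encode_inverse[OF finF] indicator_def split: if_splits)
    also have "\<dots> = card {G \<in> Pow {..<s}. (\<lambda>i. i \<in> G) \<in> E n v s}"
      by (rule card_set_decode)
    finally have sum_eq: "(\<Sum>c<2 ^ s. of_bool
     ((\<forall>i<N. char_fun (set_decode c) i = char_fun (set_decode (set_encode F)) i)
       \<and> eval_within p (char_fun (set_decode c)) s [n] = Some v)) = card {G \<in> Pow {..<s}. (\<lambda>i. i \<in> G) \<in> E n v s}"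
      (is "_ = ?card") .
    have "R g n v s \<longleftrightarrow> 2 ^ s < 2 * 2 ^ N * ?card"
      unfolding R_def sum_eq using True by simp
    also have "\<dots> \<longleftrightarrow> real (2 ^ s) < real (2 * 2 ^ N * ?card)" by (rule of_nat_less_iff[symmetric])
    also have "\<dots> \<longleftrightarrow> (1 / 2) ^ N / 2 < ?card * (1 / 2 :: real) ^ s"
      by (simp add: power_one_over field_simps)
    finally show ?thesis using True measure_depends_below[OF depE[OF True]] by simp
  qed (simp add: R_def)
  obtain t where t: "\<And>g n v. eval t g [n] = Some v \<Longrightarrow> \<exists>s. R g n v s"
      "\<And>g n. \<exists>v s. R g n v s \<Longrightarrow> eval t g [n] \<noteq> None"
    using selection[OF decR] by blast
  define d where "d n = eval t (char_fun {}) [n]" for n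
  have correct: "v = f n" if d: "d n = Some v" for n v
  proof -
    obtain s where "R (char_fun {}) n v s" using t(1) d unfolding d_def by blast
    then have E: "measure coin (E n v s) > (1 / 2) ^ N / 2" unfolding R_iff by simp
    have "C \<inter> cylinder N F \<inter> E n v s \<noteq> {}"
    proof
      assume "C \<inter> cylinder N F \<inter> E n v s = {}"
      then have "measure coin (C \<inter> cylinder N F) + measure coin (E n v s) = measure coin ((C \<inter> cylinder N F) \<union> E n v s)"
        by (intro coin.finite_measure_Union[symmetric]) (use C E_sets in auto)
      also have "\<dots> \<le> measure coin (cylinder N F)"
        by (intro coin.finite_measure_mono) (auto simp: E_def)
      finally show False using E maj by (simp add: measure_cylinder)
    qed
    then obtain x where x: "x \<in> C" "eval_within p (char_fun (Collect x)) s [n] = Some v" by (auto simp: E_def)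
    then have "eval p (char_fun (Collect x)) [n] = Some v" using eval_within_sound by blast
    with gd[OF x(1)] show ?thesis unfolding generic_description_def by (metis domI option.inject)
  qed
  let ?D = "\<lambda>k. {x. \<exists>s. eval_within p (char_fun (Collect x)) s [k] \<noteq> None}"
  have D_sets: "?D k \<in> sets coin" for k
  proof -
    have "?D k = (\<Union>s. {x. eval_within p (char_fun (Collect x)) s [k] \<noteq> None})" by blast
    also have "\<dots> \<in> sets coin"
      using depends_below_sets[OF depends_below_eval_within[of _ "\<lambda>e. e _ \<noteq> None"]] by blast
    finally show ?thesis .
  qed
  have D_iff: "x \<in> ?D k \<longleftrightarrow> k \<in> dom (\<lambda>n. eval p (char_fun (Collect x)) [n])" for x k
    unfolding dom_def mem_Collect_eq eval_defined_iff_eval_within ..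
  have "has_density {k. (1 / 2) ^ N / 2 < measure coin (C \<inter> cylinder N F \<inter> ?D k)} 1"
  proof (rule density_by_averaging)
    fix x assume "x \<in> C \<inter> cylinder N F"
    then have "has_density (dom (\<lambda>n. eval p (char_fun (Collect x)) [n])) 1"
      using gd unfolding generic_description_def by blast
    then show "has_density {k. x \<in> ?D k} 1" unfolding D_iff by simp
  qed (use C maj D_sets in auto)
  moreover have "{k. (1 / 2) ^ N / 2 < measure coin (C \<inter> cylinder N F \<inter> ?D k)} \<subseteq> dom d"
  proof
    fix k assume "k \<in> {k. (1 / 2) ^ N / 2 < measure coin (C \<inter> cylinder N F \<inter> ?D k)}"
    then have "(1 / 2) ^ N / 2 < measure coin (C \<inter> cylinder N F \<inter> ?D k)" by simp
    also have "\<dots> \<le> measure coin (\<Union>s. E k (f k) s)"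
    proof (rule coin.finite_measure_mono)
      show "C \<inter> cylinder N F \<inter> ?D k \<subseteq> (\<Union>s. E k (f k) s)"
      proof
        fix x assume x: "x \<in> C \<inter> cylinder N F \<inter> ?D k"
        then have "eval p (char_fun (Collect x)) [k] = Some (f k)"
          using gd[of x] D_iff[of x k] unfolding generic_description_def by blast
        then obtain s where "eval_within p (char_fun (Collect x)) s [k] = Some (f k)" using eval_within_complete by blast
        with x show "x \<in> (\<Union>s. E k (f k) s)" by (auto simp: E_def)
      qed
    qed (use E_sets in auto)
    finally have gt: "(1 / 2) ^ N / 2 < measure coin (\<Union>s. E k (f k) s)" .
    have "incseq (E k (f k))" unfolding incseq_def E_def using eval_within_mono by blast
    then have "(\<lambda>s. measure coin (E k (f k) s)) \<longlonglongrightarrow> measure coin (\<Union>s. E k (f k) s)"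
      using E_sets by (intro coin.finite_Lim_measure_incseq) auto
    then have "\<forall>\<^sub>F s in sequentially. (1 / 2) ^ N / 2 < measure coin (E k (f k) s)"
      using gt by (rule order_tendstoD)
    then have "\<forall>\<^sub>F s in sequentially. N \<le> s \<and> (1 / 2) ^ N / 2 < measure coin (E k (f k) s)"
      using eventually_ge_at_top[of N] by eventually_elim simp
    then obtain s where "R (char_fun {}) k (f k) s"
      unfolding R_iff by (auto simp: eventually_sequentially)
    then show "k \<in> dom d" using t(2) unfolding d_def by blast
  qed
  ultimately have "has_density (dom d) 1" by (rule has_density_1_mono)
  with correct have "generic_description d f" unfolding generic_description_def by auto
  moreover have "partial_computable d"
    unfolding partial_computable_def partial_computable_in_def d_def by blast
  ultimately show ?thesis unfolding generically_computable_def by blast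
qed


section \<open>Null classes of oracles\<close>

text \<open>
  The bound \<open>k\<close> plays two roles, as stage for the \<open>\<Pi>\<^sub>1\<close> correctness condition and as precision
  \<open>k / (k + 1)\<close> for the density, so that both conditions share one \<open>\<forall>\<exists>\<forall>\<exists>\<close> prefix.
\<close>

definition description_stage ::
  "prog \<Rightarrow> (nat \<Rightarrow> nat) \<Rightarrow> (nat \<Rightarrow> nat) \<Rightarrow> nat \<Rightarrow> nat \<Rightarrow> nat \<Rightarrow> nat \<Rightarrow> bool" where
  "description_stage p g f k N n t \<longleftrightarrow>
     (\<forall>i<k. eval_within p g k [i] = None \<or> eval_within p g k [i] = Some (f i)) \<and>
     (n < N \<or> k * n \<le> Suc k * (\<Sum>i<n. of_bool (eval_within p g t [i] \<noteq> None)))"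

lemma generic_description_iff:
  "generic_description (\<lambda>n. eval p g [n]) f \<longleftrightarrow>
     (\<forall>k. \<exists>N. \<forall>n. \<exists>t. description_stage p g f k N n t)"
proof -
  define D where "D = dom (\<lambda>n. eval p g [n])"
  have D_iff: "i \<in> D \<longleftrightarrow> (\<exists>s. eval_within p g s [i] \<noteq> None)" for i
    unfolding D_def dom_def mem_Collect_eq eval_defined_iff_eval_within ..
  have count: "(\<Sum>i<n. of_bool (eval_within p g t [i] \<noteq> None)) = card ({i. eval_within p g t [i] \<noteq> None} \<inter> {0..<n})" for n t
    by (simp add: sum_of_bool_eq atLeast0LessThan Int_commute)
  have gd: "generic_description (\<lambda>n. eval p g [n]) f \<longleftrightarrow>
      (\<forall>n v. eval p g [n] = Some v \<longrightarrow> v = f n) \<and> has_density D 1"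
    unfolding generic_description_def D_def by (auto simp: dom_def)
  show ?thesis unfolding gd
  proof (intro iffI conjI allI impI)
    fix k
    assume D: "(\<forall>n v. eval p g [n] = Some v \<longrightarrow> v = f n) \<and> has_density D 1"
    have correct: "eval_within p g k [i] = None \<or> eval_within p g k [i] = Some (f i)" for k i
    proof (cases "eval_within p g k [i]")
      case (Some v)
      then have "eval p g [i] = Some v" by (rule eval_within_sound)
      with D Some show ?thesis by simp
    qed simp
    obtain N where N: "\<And>n. n \<ge> N \<Longrightarrow> k * n \<le> Suc k * card (D \<inter> {0..<n})"
      using D unfolding has_density_1_iff by blast
    have "\<exists>t. description_stage p g f k N n t" for n
    proof -
      obtain t where t: "\<forall>i<n. (\<exists>r. eval_within p g r [i] \<noteq> None) \<longrightarrow> eval_within p g t [i] \<noteq> None"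
        using eval_within_uniform[of n "\<lambda>_. p" g "\<lambda>i. [i]"] by blast
      have "i \<in> D \<longleftrightarrow> eval_within p g t [i] \<noteq> None" if "i < n" for i
        using t that unfolding D_iff by blast
      then have eq: "D \<inter> {0..<n} = {i. eval_within p g t [i] \<noteq> None} \<inter> {0..<n}"
        by (auto simp del: not_None_eq)
      have "n < N \<or> k * n \<le> Suc k * card (D \<inter> {0..<n})"
        using N[of n] not_less by blast
      then have "description_stage p g f k N n t"
        unfolding description_stage_def count eq using correct by blast
      then show ?thesis ..
    qed
    then show "\<exists>N. \<forall>n. \<exists>t. description_stage p g f k N n t" by blast
  next
    fix n v
    assume st: "\<forall>k. \<exists>N. \<forall>n. \<exists>t. description_stage p g f k N n t" and v: "eval p g [n] = Some v"
    obtain s where s: "eval_within p g s [n] = Some v" using eval_within_complete[OF v] ..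
    define k where "k = Suc (max n s)"
    have eval_within_k: "eval_within p g k [n] = Some v" using s by (rule eval_within_mono) (simp add: k_def)
    obtain N t where "description_stage p g f k N 0 t" using st by blast
    then have "\<forall>i<k. eval_within p g k [i] = None \<or> eval_within p g k [i] = Some (f i)"
      unfolding description_stage_def by (rule conjunct1)
    moreover have "n < k" by (simp add: k_def)
    ultimately have "eval_within p g k [n] = None \<or> eval_within p g k [n] = Some (f n)" by blast
    with eval_within_k show "v = f n" by simp
  next
    assume st: "\<forall>k. \<exists>N. \<forall>n. \<exists>t. description_stage p g f k N n t"
    show "has_density D 1"
      unfolding has_density_1_iff
    proof
      fix k
      obtain N where N: "\<forall>n. \<exists>t. description_stage p g f k N n t" using st by blast
      have "k * n \<le> Suc k * card (D \<inter> {0..<n})" if n: "n \<ge> N" for n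
      proof -
        obtain t where "description_stage p g f k N n t" using N by blast
        then have "k * n \<le> Suc k * card ({i. eval_within p g t [i] \<noteq> None} \<inter> {0..<n})"
          using n unfolding description_stage_def count by simp
        also have "\<dots> \<le> Suc k * card (D \<inter> {0..<n})"
          by (intro mult_le_mono2 card_mono) (use D_iff in blast)+
        finally show ?thesis .
      qed
      then show "\<exists>N. \<forall>n\<ge>N. k * n \<le> Suc k * card (D \<inter> {0..<n})" by blast
    qed
  qed
qed

lemma description_stage_sets: "{x. description_stage p (char_fun (Collect x)) f k N n t} \<in> sets coin"
proof -
  have "{x. description_stage p (char_fun (Collect x)) f k N n t} =
    {x. \<forall>i<k. eval_within p (char_fun (Collect x)) k [i] = None \<or> eval_within p (char_fun (Collect x)) k [i] = Some (f i)} \<inter>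
    {x. n < N \<or> k * n \<le> Suc k * (\<Sum>i<n. of_bool (eval_within p (char_fun (Collect x)) t [i] \<noteq> None))}"
    by (auto simp: description_stage_def)
  also have "\<dots> \<in> sets coin"
    by (intro sets.Int depends_below_sets[OF depends_below_eval_within[of k "\<lambda>e. \<forall>i<k. e [i] = None \<or> e [i] = Some (f i)"]]
      depends_below_sets[OF depends_below_eval_within[of t "\<lambda>e. n < N \<or> k * n \<le> Suc k * (\<Sum>i<n. of_bool (e [i] \<noteq> None))"]])
  finally show ?thesis .
qed

lemma description_class_sets:
  "{x. generic_description (\<lambda>n. eval p (char_fun (Collect x)) [n]) f} \<in> sets coin"
proof -
  let ?S = "\<lambda>k N n t. {x. description_stage p (char_fun (Collect x)) f k N n t}"
  have "(\<Union>t. ?S k N n t) \<in> sets coin" for k N n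
    by (rule sets.countable_UN) (use description_stage_sets in blast)
  then have "(\<Inter>n. \<Union>t. ?S k N n t) \<in> sets coin" for k N
    by (intro sets.countable_INT) auto
  then have "(\<Union>N. \<Inter>n. \<Union>t. ?S k N n t) \<in> sets coin" for k
    by (intro sets.countable_UN) auto
  then have "(\<Inter>k. \<Union>N. \<Inter>n. \<Union>t. ?S k N n t) \<in> sets coin"
    by (intro sets.countable_INT) auto
  also have "(\<Inter>k. \<Union>N. \<Inter>n. \<Union>t. ?S k N n t) = {x. generic_description (\<lambda>n. eval p (char_fun (Collect x)) [n]) f}"
    unfolding generic_description_iff by auto
  finally show ?thesis .
qed

lemma description_class_null:
  assumes "\<not> generically_computable f"
  shows "{X. generic_description (\<lambda>n. eval p (char_fun X) [n]) f} \<in> null_sets cantor_measure"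
proof (rule null_sets_cantor_measureI)
  let ?C = "{x. Collect x \<in> {X. generic_description (\<lambda>n. eval p (char_fun X) [n]) f}}"
  have "?C \<in> sets coin" using description_class_sets[of p f] by simp
  moreover have "measure coin ?C = 0"
  proof (rule ccontr)
    assume "measure coin ?C \<noteq> 0"
    then have "measure coin ?C > 0" by (simp add: zero_less_measure_iff)
    from majority_vote[OF \<open>?C \<in> sets coin\<close> this, of p f] assms show False by simp
  qed
  ultimately show "?C \<in> null_sets coin"
    by (simp add: null_sets_def coin.emeasure_eq_measure)
qed

lemma description_class_pi:
  "pi_class 4 f {X. generic_description (\<lambda>n. eval p (char_fun X) [n]) f}"
proof -
  have "decidable 4 (\<lambda>g xs. description_stage p (\<lambda>i. g (2 * i)) (\<lambda>i. g (2 * i + 1)) (xs ! 0) (xs ! 1) (xs ! 2) (xs ! 3))"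
    unfolding description_stage_def
    by (intro recursive_intros decidable_eval_within_eq_None[of "\<lambda>g c i. g (2 * i)", where C = "\<lambda>g xs. 0"]
        decidable_eval_within_eq_Some[of "\<lambda>g c i. g (2 * i)", where C = "\<lambda>g xs. 0"]) auto
  then obtain q where q: "\<And>g xs. length xs = 4 \<Longrightarrow> eval q g xs = Some (of_bool
      (description_stage p (\<lambda>i. g (2 * i)) (\<lambda>i. g (2 * i + 1)) (xs ! 0) (xs ! 1) (xs ! 2) (xs ! 3)))"
    unfolding decidable_def recursive_def by blast
  have join: "(\<lambda>i. oracle_join a b (2 * i)) = a" "(\<lambda>i. oracle_join a b (2 * i + 1)) = b" for a b
    by (auto simp: oracle_join_def)
  let ?R = "\<lambda>X ms. description_stage p (char_fun X) f (ms ! 0) (ms ! 1) (ms ! 2) (ms ! 3)"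
  have "\<forall>X ms. length ms = 4 \<longrightarrow> eval q (oracle_join (char_fun X) f) ms = Some (of_bool (?R X ms))"
    using q[of _ "oracle_join _ f"] unfolding join by blast
  moreover have "{X. generic_description (\<lambda>n. eval p (char_fun X) [n]) f} = {X. pi_form 4 (?R X)}"
    unfolding generic_description_iff by (simp add: numeral_eq_Suc)
  ultimately show ?thesis unfolding pi_class_def by (intro exI[of _ q] exI[of _ ?R] conjI)
qed

instance prog :: countable
  by countable_datatype

lemma generically_computable_in_iff:
  "generically_computable_in X f \<longleftrightarrow> (\<exists>p. generic_description (\<lambda>n. eval p (char_fun X) [n]) f)"
  unfolding generically_computable_in_def partial_computable_in_def
proof
  assume "\<exists>d. (\<exists>p. \<forall>n. d n = eval p (char_fun X) [n]) \<and> generic_description d f"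
  then obtain d p where "\<forall>n. d n = eval p (char_fun X) [n]" "generic_description d f" by blast
  moreover from this have "d = (\<lambda>n. eval p (char_fun X) [n])" by blast
  ultimately show "\<exists>p. generic_description (\<lambda>n. eval p (char_fun X) [n]) f" by blast
next
  assume "\<exists>p. generic_description (\<lambda>n. eval p (char_fun X) [n]) f"
  then obtain p where "generic_description (\<lambda>n. eval p (char_fun X) [n]) f" ..
  then show "\<exists>d. (\<exists>p. \<forall>n. d n = eval p (char_fun X) [n]) \<and> generic_description d f"
    by (intro exI[of _ "\<lambda>n. eval p (char_fun X) [n]"]) auto
qed

lemma generically_computable_in_null:
  assumes "\<not> generically_computable f"
  shows "{X. generically_computable_in X f} \<in> null_sets cantor_measure"
proof -
  have "{X. generically_computable_in X f} =
      (\<Union>p. {X. generic_description (\<lambda>n. eval p (char_fun X) [n]) f})"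
    unfolding generically_computable_in_iff by blast
  also have "\<dots> \<in> null_sets cantor_measure"
    using description_class_null[OF assms] by (intro null_sets_UN)
  finally show ?thesis .
qed

lemma recursive_prod_encode:
  assumes "recursive k A" "recursive k B"
  shows "recursive k (\<lambda>g xs. prod_encode (A g xs, B g xs))"
  unfolding prod_encode_def triangle_def split_conv by (intro recursive_intros assms)

lemma ng_reducible_imp_generically_computable_in:
  assumes "h \<le>\<^sub>n\<^sub>g char_fun X"
  shows "generically_computable_in X h"
proof -
  define d where "d = (\<lambda>n. Some (char_fun X n))"
  have "has_density (dom d) 1"
    unfolding has_density_1_iff by (simp add: d_def dom_def)
  then have "generic_description d (char_fun X)" by (simp add: generic_description_def d_def)
  then obtain e W where e: "generic_description e h" and W: "enumeration_operator W"
    and gra_e: "gra e = enum_apply W (gra d)"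
    using assms unfolding ng_reducible_def enum_reducible_def by blast
  let ?S = "(\<lambda>(F, k). prod_encode (set_encode F, k)) ` W"
  obtain w where w: "?S = {c. eval w (char_fun {}) [c] \<noteq> None}"
    using W unfolding enumeration_operator_def ce_def partial_computable_def partial_computable_in_def
    by (auto simp: dom_def)
  have S_iff: "prod_encode (u, k) \<in> ?S \<longleftrightarrow> (set_decode u, k) \<in> W" for u k
  proof
    assume "prod_encode (u, k) \<in> ?S"
    then obtain F where "(F, k) \<in> W" "u = set_encode F" by auto
    with W show "(set_decode u, k) \<in> W" by (auto simp: enumeration_operator_def set_encode_inverse)
  next
    assume "(set_decode u, k) \<in> W"
    then show "prod_encode (u, k) \<in> ?S" by (intro image_eqI[of _ _ "(set_decode u, k)"]) auto
  qed
  have S_eval_within: "c \<in> ?S \<longleftrightarrow> (\<exists>s. eval_within w (char_fun (set_decode 0)) s [c] \<noteq> None)" for c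
    unfolding w mem_Collect_eq eval_defined_iff_eval_within by simp
  define R where "R g n v s \<longleftrightarrow> (\<exists>u<s. \<not> eval_within w (char_fun (set_decode 0)) s [prod_encode (u, prod_encode (n, v))] = None \<and>
      (\<forall>j<u. char_fun (set_decode u) j = 1 \<longrightarrow> (\<exists>a<Suc j. j = prod_encode (a, g a))))" for g n v s
  have decR: "decidable 3 (\<lambda>g xs. R g (xs ! 0) (xs ! 1) (xs ! 2))"
    unfolding R_def
    by (intro recursive_intros recursive_set_decode recursive_prod_encode
        decidable_eval_within_eq_None[of "\<lambda>g c. char_fun (set_decode c)", where C = "\<lambda>g xs. 0"]) auto
  obtain t where t: "\<And>g n v. eval t g [n] = Some v \<Longrightarrow> \<exists>s. R g n v s"
      "\<And>g n. \<exists>v s. R g n v s \<Longrightarrow> eval t g [n] \<noteq> None"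
    using selection[OF decR] by blast
  have gra_d: "(\<forall>j<u. char_fun (set_decode u) j = (1::nat) \<longrightarrow> (\<exists>a<Suc j. j = prod_encode (a, char_fun X a)))
      \<longleftrightarrow> set_decode u \<subseteq> gra d" for u
  proof
    assume l: "\<forall>j<u. char_fun (set_decode u) j = (1::nat) \<longrightarrow> (\<exists>a<Suc j. j = prod_encode (a, char_fun X a))"
    show "set_decode u \<subseteq> gra d"
    proof
      fix j assume j: "j \<in> set_decode u"
      then have "2 ^ j \<le> u" by (rule_tac ccontr) (simp add: set_decode_def)
      with less_exp[of j] have "j < u" by linarith
      with l j show "j \<in> gra d" by (auto simp: gra_def d_def)
    qed
  next
    assume r: "set_decode u \<subseteq> gra d"
    show "\<forall>j<u. char_fun (set_decode u) j = (1::nat) \<longrightarrow> (\<exists>a<Suc j. j = prod_encode (a, char_fun X a))"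
    proof (intro allI impI)
      fix j assume "char_fun (set_decode u) j = (1::nat)"
      then have "j \<in> gra d" using r by (cases "j \<in> set_decode u") auto
      then obtain a where "j = prod_encode (a, char_fun X a)" by (auto simp: gra_def d_def)
      then show "\<exists>a<Suc j. j = prod_encode (a, char_fun X a)"
        using le_prod_encode_1[of a "char_fun X a"] by (auto simp: less_Suc_eq_le)
    qed
  qed
  have R_iff: "(\<exists>s. R (char_fun X) n v s) \<longleftrightarrow> e n = Some v" for n v
  proof -
    let ?k = "prod_encode (n, v)"
    have "(\<exists>s. R (char_fun X) n v s) \<longleftrightarrow> (\<exists>u. prod_encode (u, ?k) \<in> ?S \<and> set_decode u \<subseteq> gra d)"
    proof
      assume "\<exists>s. R (char_fun X) n v s"
      then show "\<exists>u. prod_encode (u, ?k) \<in> ?S \<and> set_decode u \<subseteq> gra d"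
        unfolding R_def gra_d S_eval_within by blast
    next
      assume "\<exists>u. prod_encode (u, ?k) \<in> ?S \<and> set_decode u \<subseteq> gra d"
      then obtain u s where us: "eval_within w (char_fun (set_decode 0)) s [prod_encode (u, ?k)] \<noteq> None" "set_decode u \<subseteq> gra d"
        unfolding S_eval_within by blast
      have "eval_within w (char_fun (set_decode 0)) (Suc (max u s)) [prod_encode (u, ?k)] \<noteq> None"
        using us(1) eval_within_mono[OF _ le_SucI[OF max.cobounded2]] by (metis not_None_eq)
      then have "R (char_fun X) n v (Suc (max u s))"
        unfolding R_def gra_d using us(2) by (intro exI[of _ u]) auto
      then show "\<exists>s. R (char_fun X) n v s" ..
    qed
    also have "\<dots> \<longleftrightarrow> ?k \<in> enum_apply W (gra d)"
      unfolding S_iff enum_apply_def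
    proof safe
      fix F assume "(F, ?k) \<in> W" "F \<subseteq> gra d"
      moreover from this W have "finite F" by (auto simp: enumeration_operator_def)
      ultimately show "\<exists>u. (set_decode u, ?k) \<in> W \<and> set_decode u \<subseteq> gra d"
        by (intro exI[of _ "set_encode F"]) (simp add: set_encode_inverse)
    qed blast
    also have "\<dots> \<longleftrightarrow> e n = Some v" unfolding gra_e[symmetric] by (auto simp: gra_def)
    finally show ?thesis .
  qed
  have "eval t (char_fun X) [n] = e n" for n
  proof (cases "eval t (char_fun X) [n]")
    case None
    then have "\<nexists>v. e n = Some v" using t(2) unfolding R_iff[symmetric] by blast
    with None show ?thesis by (cases "e n") auto
  next
    case (Some v)
    with t(1)[OF Some] show ?thesis unfolding R_iff by simp
  qed
  then have "e = (\<lambda>n. eval t (char_fun X) [n])" by simp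
  with e show ?thesis unfolding generically_computable_in_iff by blast
qed

lemma ug_reducible_imp_ng_reducible:
  assumes "h \<le>\<^sub>u\<^sub>g g"
  shows "h \<le>\<^sub>n\<^sub>g g"
  unfolding ng_reducible_def enum_reducible_def
proof (intro allI impI)
  fix d assume d: "generic_description d g"
  obtain W where W: "enumeration_operator W"
    and *: "\<forall>d. generic_description d g \<longrightarrow>
        (\<exists>e. generic_description e h \<and> enum_apply W (gra d) = gra e)"
    using assms unfolding ug_reducible_def by (elim exE conjE)
  obtain e where "generic_description e h" "enum_apply W (gra d) = gra e"
    using *[THEN spec, THEN mp, OF d] by (elim exE conjE)
  with W show "\<exists>e. generic_description e h \<and>
      (\<exists>W. enumeration_operator W \<and> gra e = enum_apply W (gra d))"
    by (intro exI[of _ e] exI[of _ W] conjI) simp_all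
qed

theorem theorem6p3:
  shows "(\<forall>f :: nat \<Rightarrow> nat. \<not> generically_computable f \<longrightarrow>
            {X. generically_computable_in X f} \<in> null_sets cantor_measure \<and>
            (\<forall>X. generically_computable_in X f \<longrightarrow> \<not> weakly_random 4 f X)) \<and>
         (\<forall>A :: nat set. \<not> generically_computable (char_fun A) \<longrightarrow>
            {X. char_fun A \<le>\<^sub>u\<^sub>g char_fun X} \<in> null_sets cantor_measure \<and>
            {X. char_fun A \<le>\<^sub>n\<^sub>g char_fun X} \<in> null_sets cantor_measure)"
proof (intro conjI allI impI)
  fix f :: "nat \<Rightarrow> nat" assume f: "\<not> generically_computable f"
  show "{X. generically_computable_in X f} \<in> null_sets cantor_measure"
    by (rule generically_computable_in_null[OF f])
  fix X assume "generically_computable_in X f"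
  then obtain p where "X \<in> {X. generic_description (\<lambda>n. eval p (char_fun X) [n]) f}"
    unfolding generically_computable_in_iff by blast
  then show "\<not> weakly_random 4 f X"
    unfolding weakly_random_def using description_class_pi description_class_null[OF f] by blast
next
  fix A :: "nat set" assume A: "\<not> generically_computable (char_fun A)"
  have null: "{X. generically_computable_in X (char_fun A)} \<in> null_sets cantor_measure"
    by (rule generically_computable_in_null[OF A])
  show "{X. char_fun A \<le>\<^sub>n\<^sub>g char_fun X} \<in> null_sets cantor_measure"
    using null unfolding cantor_measure_def
    by (rule null_sets_completion_subset[rotated])
      (use ng_reducible_imp_generically_computable_in in auto)
  show "{X. char_fun A \<le>\<^sub>u\<^sub>g char_fun X} \<in> null_sets cantor_measure"
    using null unfolding cantor_measure_def
    by (rule null_sets_completion_subset[rotated])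
      (use ng_reducible_imp_generically_computable_in ug_reducible_imp_ng_reducible in auto)
qed

end
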